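(* Let $n\geq 1$ and let $F=x_0^{a_0}\cdots x_n^{a_n}\in\mathbb{C}[x_0,\dots,x_n]$ with $0<a_0\leq a_1\leq\cdots\leq a_n$ and $a_n\geq\left(\sum_{i=0}^{n-1}a_i\right)-2$. Then \[ \underline{\mathbf{rk}}(F)=\prod_{i=0}^{n-1}(a_i+1). \]
   Context: $\underline{\mathbf{rk}}(F)$ is the (Waring) border rank of the form $F$ of degree $d=\sum a_i$: the least $r\geq1$ such that $[F]$ lies in the $r$-th secant variety $\sigma_r(\nu_d(\mathbb{P}^n))\subset\mathbb{P}(\mathbb{C}[x_0,\dots,x_n]_d)$ of the $d$-th Veronese variety, i.e. such that $F$ is a limit of sums of $r$ $d$-th powers of linear forms. *)

theory Defs
  imports Complex_Main "HOL-Library.Poly_Mapping"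
begin

text \<open>
  A polynomial is a finitely supported map from exponent vectors to coefficients, with the
  convolution product of \<^theory>\<open>HOL-Library.Poly_Mapping\<close>. The variables are
  \<open>x\<^sub>0, x\<^sub>1, \<dots>\<close>; an argument \<open>n\<close> below always refers to the
  subring in \<open>x\<^sub>0, \<dots>, x\<^sub>n\<close>.
\<close>

type_synonym cpoly = "(nat \<Rightarrow>\<^sub>0 nat) \<Rightarrow>\<^sub>0 complex"

definition Const :: "complex \<Rightarrow> cpoly" where
  "Const c = Poly_Mapping.single 0 c"

definition X :: "nat \<Rightarrow> cpoly" where
  "X i = Poly_Mapping.single (Poly_Mapping.single i 1) 1"

definition forms :: "nat \<Rightarrow> nat \<Rightarrow> cpoly set" where
  "forms n d = {F. \<forall>m \<in> Poly_Mapping.keys F.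
     Poly_Mapping.keys m \<subseteq> {..n} \<and>
     (\<Sum>i\<in>Poly_Mapping.keys m. Poly_Mapping.lookup m i) = d}"

definition linear_forms :: "nat \<Rightarrow> cpoly set" where
  "linear_forms n = {\<Sum>i\<le>n. Const (c i) * X i | c. True}"

text \<open>
  Subvarieties of the projective space of \<open>forms n d\<close> are represented by their affine cones,
  so \<open>[F]\<close> lies in the variety iff \<open>F\<close> lies in the cone.
\<close>

definition veronese_cone :: "nat \<Rightarrow> nat \<Rightarrow> cpoly set" where
  "veronese_cone n d = {L ^ d | L. L \<in> linear_forms n}"

text \<open>
  Scalars are absorbed into the summands, as \<open>\<complex>\<close> is algebraically closed, and a summand may
  be \<open>0\<close>. As \<open>forms n d\<close> is finite-dimensional, its Euclidean topology is that of
  coefficientwise convergence; the Euclidean closure of the set of sums of \<open>r\<close> powers agrees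
  with its Zariski closure.
\<close>

definition secant_cone :: "nat \<Rightarrow> nat \<Rightarrow> nat \<Rightarrow> cpoly set" where
  "secant_cone n d r = {F \<in> forms n d.
     \<exists>G. (\<forall>k::nat. \<exists>v. (\<forall>j<r. v j \<in> veronese_cone n d) \<and> G k = (\<Sum>j<r. v j)) \<and>
         (\<forall>m. (\<lambda>k. Poly_Mapping.lookup (G k) m) \<longlonglongrightarrow> Poly_Mapping.lookup F m)}"

text \<open>Only meaningful for nonzero \<open>F \<in> forms n d\<close> with \<open>d \<ge> 1\<close>.\<close>

definition border_rank :: "nat \<Rightarrow> nat \<Rightarrow> cpoly \<Rightarrow> nat" where
  "border_rank n d F = (LEAST r. r \<ge> 1 \<and> F \<in> secant_cone n d r)"

end

theory Submission
  imports Defs "HOL-Analysis.Analysis"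
begin

text \<open>
  The upper bound is an explicit degeneration over roots of unity. For the lower bound, let \<open>F\<close>
  be the limit of \<open>F\<^sub>t\<close>, a sum of \<open>d\<close>-th powers of linear forms given by \<open>r\<close> points. As in
  border apolarity, the homogeneous ideals of these points have a limit ideal, contained in the
  annihilator of \<open>F\<close>, with the same Hilbert function, which is nondecreasing and at most \<open>r\<close>.
  Since \<open>F\<close> is a monomial, its annihilator is a monomial ideal, so one may pass to the initial
  ideal: the standard monomials form a set that is closed under divisors, contains the divisors
  of \<open>x\<^sup>a\<close>, and has at most \<open>r\<close> elements in each degree, with nondecreasing counts.

  Let \<open>P\<close> be the claimed rank and suppose \<open>r < P\<close>. Then \<open>a\<^sub>n < a\<^sub>0 + \<dots> + a\<^sub>m\<close> for
  \<open>m = n - 1\<close>, as otherwise \<open>x\<^sup>a\<close> has \<open>P\<close> divisors of that degree. In degree \<open>a\<^sub>n + 1\<close> at least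
  \<open>P - 2\<close> monomials divide \<open>x\<^sup>a\<close>, so at most one standard monomial \<open>u\<close> does not. Every standard monomial of degree
  above \<open>d\<close> is a multiple of \<open>u\<close>, and monotonicity asks for \<open>P - 1\<close> of these. If \<open>u\<close> is not a
  pure power of a variable \<open>x\<^sub>k\<close> with \<open>a\<^sub>k = a\<^sub>n\<close>, at most one is left. If it is, they are
  homogenisations with \<open>x\<^sub>k\<close> of the \<open>P\<close> divisors of \<open>x\<^sup>a\<close> without \<open>x\<^sub>k\<close>. In degree
  \<open>a\<^sub>0 + \<dots> + a\<^sub>n - a\<^sub>k\<close> one of these is not standard, by \<open>r < P\<close>, and it is not \<open>x\<^sup>a / x\<^sub>k ^ a\<^sub>k\<close>, so it
  has a proper multiple among the \<open>P\<close> divisors; hence at least two are missing in higher degrees.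
\<close>

subsection \<open>Linear systems and limits along ultrafilters\<close>

text \<open>Gaussian elimination: an equation with a nonzero coefficient is solved for the unknown
  \<open>b0\<close> and substituted into the others, which removes one equation and one
  unknown.\<close>

lemma homogeneous_system_nontrivial:
  fixes M :: "'a \<Rightarrow> 'b \<Rightarrow> 'c::field"
  assumes "finite J" "finite B" "card J < card B"
  shows "\<exists>g. (\<exists>b\<in>B. g b \<noteq> 0) \<and> (\<forall>j\<in>J. (\<Sum>b\<in>B. g b * M j b) = 0)"
  using assms
proof (induction J arbitrary: B M rule: finite_induct)
  case empty
  then have "B \<noteq> {}" by auto
  then show ?case by (intro exI[of _ "\<lambda>_. 1"]) auto
next
  case (insert j J)
  show ?case
  proof (cases "\<forall>b\<in>B. M j b = 0")
    case True
    obtain g where "\<exists>b\<in>B. g b \<noteq> 0" "\<forall>j\<in>J. (\<Sum>b\<in>B. g b * M j b) = 0"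
      using insert.IH[of B M] insert.prems insert.hyps by auto
    with True show ?thesis by (intro exI[of _ g]) auto
  next
    case False
    then obtain b0 where b0: "b0 \<in> B" "M j b0 \<noteq> 0" by auto
    define B' where "B' = B - {b0}"
    have B': "B = insert b0 B'" "b0 \<notin> B'" "finite B'"
      using b0 insert.prems by (auto simp: B'_def)
    have "card J < card B'" using insert B' by auto
    then obtain g where g: "\<exists>b\<in>B'. g b \<noteq> 0"
      "\<forall>i\<in>J. (\<Sum>b\<in>B'. g b * (M i b - M i b0 * (M j b / M j b0))) = 0"
      using insert.IH[of B' "\<lambda>i b. M i b - M i b0 * (M j b / M j b0)"] B' by auto
    \<comment> \<open>The value of \<open>b0\<close> that equation \<open>j\<close>
      dictates.\<close>
    define s where "s = - (\<Sum>b\<in>B'. g b * (M j b / M j b0))"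
    define h where "h = g(b0 := s)"
    have h: "(\<Sum>b\<in>B. h b * M i b) = s * M i b0 + (\<Sum>b\<in>B'. g b * M i b)" for i
    proof -
      have "(\<Sum>b\<in>B'. h b * M i b) = (\<Sum>b\<in>B'. g b * M i b)"
        using B' by (intro sum.cong) (auto simp: h_def)
      then show ?thesis using B' by (simp add: h_def)
    qed
    have "s * M j b0 = - (\<Sum>b\<in>B'. g b * M j b)"
      using b0 by (simp add: s_def sum_distrib_right)
    then have "(\<Sum>b\<in>B. h b * M j b) = 0" by (simp add: h)
    moreover have "(\<Sum>b\<in>B. h b * M i b) = 0" if "i \<in> J" for i
    proof -
      have "0 = (\<Sum>b\<in>B'. g b * (M i b - M i b0 * (M j b / M j b0)))" using g that by simp
      also have "\<dots> = (\<Sum>b\<in>B'. g b * M i b) + s * M i b0"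
        by (simp add: s_def algebra_simps sum_subtractf sum_distrib_left)
      finally show ?thesis by (simp add: h add.commute)
    qed
    moreover have "\<exists>b\<in>B. h b \<noteq> 0" using g B' by (auto simp: h_def)
    ultimately show ?thesis by auto
  qed
qed

lemma normalize_finite_support:
  fixes g :: "'a \<Rightarrow> complex"
  assumes "finite B" "\<exists>b\<in>B. g b \<noteq> 0"
  shows "\<exists>c. c \<noteq> 0 \<and> (\<forall>b\<in>B. norm (c * g b) \<le> 1) \<and> (\<exists>b\<in>B. c * g b = 1)"
proof -
  have "finite ((\<lambda>b. norm (g b)) ` B)" "(\<lambda>b. norm (g b)) ` B \<noteq> {}" using assms by auto
  then have "Max ((\<lambda>b. norm (g b)) ` B) \<in> (\<lambda>b. norm (g b)) ` B" by (rule Max_in)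
  then obtain b0 where "b0 \<in> B" "norm (g b0) = Max ((\<lambda>b. norm (g b)) ` B)" by force
  then have b0: "b0 \<in> B" "\<And>b. b \<in> B \<Longrightarrow> norm (g b) \<le> norm (g b0)"
    using assms(1) by auto
  have "g b0 \<noteq> 0" using assms(2) b0 by fastforce
  then show ?thesis using b0
    by (intro exI[of _ "inverse (g b0)"]) (auto simp: norm_mult norm_divide norm_inverse field_simps)
qed

section \<open>Ultrafilters and convergence in compact sets\<close>

definition is_ultrafilter :: "'a filter \<Rightarrow> bool" where
  "is_ultrafilter U \<longleftrightarrow> U \<noteq> bot \<and> (\<forall>P. eventually P U \<or> eventually (\<lambda>x. \<not> P x) U)"

text \<open>Zorn's lemma gives a minimal proper filter below \<open>F\<close>. If the complement of
  \<open>P\<close> is not eventual, the meet with \<open>principal {x. P x}\<close> is proper, hence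
  by minimality the filter itself.\<close>

lemma ultrafilter_ex:
  fixes F :: "'a filter"
  assumes "F \<noteq> bot"
  shows "\<exists>U. is_ultrafilter U \<and> U \<le> F"
proof -
  define A where "A = {G. G \<noteq> bot \<and> G \<le> F}"
  have "\<exists>m\<in>A. \<forall>a\<in>A. m \<ge> a \<longrightarrow> a = m"
  proof (rule predicate_Zorn)
    show "partial_order_on A (relation_of (\<lambda>a b. a \<ge> b) A)"
      by (auto simp: partial_order_on_def preorder_on_def refl_on_def trans_def antisym_def relation_of_def)
    fix C assume "C \<in> Chains (relation_of (\<lambda>a b. a \<ge> b) A)"
    then have C: "C \<subseteq> A" "\<And>x y. x \<in> C \<Longrightarrow> y \<in> C \<Longrightarrow> x \<le> y \<or> y \<le> x"
      by (auto simp: Chains_def relation_of_def)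
    show "\<exists>u\<in>A. \<forall>a\<in>C. u \<le> a"
    proof (cases "C = {}")
      case True
      then show ?thesis using assms by (auto simp: A_def)
    next
      case False
      have "Inf C \<noteq> bot"
      proof -
        \<comment> \<open>What holds eventually for the infimum of a nonempty chain already does for
          a member, so the infimum is proper.\<close>
        have "eventually P (Inf C) \<longleftrightarrow> (\<exists>b\<in>C. eventually P b)" for P
        proof (rule eventually_Inf_base[OF False])
          fix x y assume "x \<in> C" "y \<in> C"
          then show "\<exists>z\<in>C. z \<le> inf x y" using C(2) by (metis inf.absorb1 inf.absorb2 order_refl)
        qed
        then show ?thesis using C(1) by (auto simp: trivial_limit_def A_def)
      qed
      moreover have "Inf C \<le> F" using False C(1) by (auto simp: A_def intro: Inf_lower2)
      ultimately show ?thesis by (intro bexI[of _ "Inf C"]) (auto simp: A_def Inf_lower)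
    qed
  qed
  then obtain U where U: "U \<noteq> bot" "U \<le> F" and max: "\<And>G. G \<noteq> bot \<Longrightarrow> G \<le> U \<Longrightarrow> G = U"
    by (fastforce simp: A_def)
  have "eventually P U" if "\<not> eventually (\<lambda>x. \<not> P x) U" for P
  proof -
    have "inf U (principal {x. P x}) \<noteq> bot"
      using that by (auto simp: trivial_limit_def eventually_inf_principal)
    then have "inf U (principal {x. P x}) = U" using max by auto
    moreover have "eventually P (inf U (principal {x. P x}))"
      by (simp add: eventually_inf_principal)
    ultimately show ?thesis by simp
  qed
  then show ?thesis using U unfolding is_ultrafilter_def by blast
qed

lemma ultrafilter_not_eventually:
  "is_ultrafilter U \<Longrightarrow> \<not> eventually P U \<longleftrightarrow> eventually (\<lambda>x. \<not> P x) U"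
  using eventually_conj[of P U "\<lambda>x. \<not> P x"] unfolding is_ultrafilter_def trivial_limit_def by auto

text \<open>Compactness gives a cluster point, and an ultrafilter converges to each of its cluster
  points. So limits exist without passing to subsequences, and the same \<open>U\<close> serves all
  degrees.\<close>

lemma ultrafilter_tendsto_compact:
  fixes f :: "'a \<Rightarrow> 'b::topological_space"
  assumes "is_ultrafilter U" "compact K" "eventually (\<lambda>x. f x \<in> K) U"
  shows "\<exists>l\<in>K. (f \<longlongrightarrow> l) U"
proof -
  have "U \<noteq> bot" using assms(1) by (simp add: is_ultrafilter_def)
  then have "filtermap f U \<noteq> bot" by (simp add: filtermap_bot_iff)
  moreover have "eventually (\<lambda>y. y \<in> K) (filtermap f U)"
    using assms(3) by (simp add: eventually_filtermap)
  ultimately obtain l where l: "l \<in> K" "inf (nhds l) (filtermap f U) \<noteq> bot"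
    using assms(2) unfolding compact_filter by meson
  have "eventually (\<lambda>x. f x \<in> S) U" if S: "open S" "l \<in> S" for S
  proof (rule ccontr)
    assume "\<not> ?thesis"
    then have "eventually (\<lambda>y. y \<notin> S) (filtermap f U)"
      using ultrafilter_not_eventually[OF assms(1)] by (simp add: eventually_filtermap)
    moreover have "eventually (\<lambda>y. y \<in> S) (nhds l)" using S by (rule eventually_nhds_in_open)
    ultimately have "eventually (\<lambda>_. False) (inf (nhds l) (filtermap f U))"
      unfolding eventually_inf by blast
    with l show False by (simp add: trivial_limit_def)
  qed
  with l show ?thesis by (auto simp: tendsto_def)
qed

text \<open>Normalising each vector to have maximum norm \<open>1\<close> keeps the limit from vanishing.\<close>

lemma ultrafilter_limit_normalized:
  fixes g :: "'t \<Rightarrow> 'a \<Rightarrow> complex"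
  assumes U: "is_ultrafilter U" and B: "finite B"
    and ev: "eventually (\<lambda>t. \<exists>b\<in>B. g t b \<noteq> 0) U"
  shows "\<exists>c l. (\<forall>b\<in>B. ((\<lambda>t. c t * g t b) \<longlongrightarrow> l b) U) \<and> (\<exists>b\<in>B. l b \<noteq> 0)"
proof -
  define good where "good t c \<longleftrightarrow> c \<noteq> 0 \<and> (\<forall>b\<in>B. norm (c * g t b) \<le> 1) \<and> (\<exists>b\<in>B. c * g t b = 1)"
    for t and c :: complex
  define c where "c t = (SOME c. good t c)" for t
  have ev': "eventually (\<lambda>t. good t (c t)) U"
    using ev
  proof eventually_elim
    case (elim t)
    have "\<exists>c. good t c" unfolding good_def by (rule normalize_finite_support[OF B elim])
    then show ?case unfolding c_def by (rule someI_ex)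
  qed
  have "\<exists>l. ((\<lambda>t. c t * g t b) \<longlongrightarrow> l) U" if "b \<in> B" for b
  proof -
    have "eventually (\<lambda>t. c t * g t b \<in> cball 0 1) U"
      using ev' by eventually_elim (use that in \<open>auto simp: good_def\<close>)
    from ultrafilter_tendsto_compact[OF U compact_cball this] show ?thesis by auto
  qed
  then obtain l where l: "\<And>b. b \<in> B \<Longrightarrow> ((\<lambda>t. c t * g t b) \<longlongrightarrow> l b) U" by metis
  have "\<exists>b\<in>B. l b \<noteq> 0"
  proof (rule ccontr)
    assume "\<not> ?thesis"
    then have "eventually (\<lambda>t. norm (c t * g t b) < 1) U" if "b \<in> B" for b
      using order_tendstoD(2)[OF tendsto_norm[OF l[OF that]], of 1] that by simp
    then have "eventually (\<lambda>t. \<forall>b\<in>B. norm (c t * g t b) < 1) U"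
      using B by (simp add: eventually_ball_finite)
    with ev' have "eventually (\<lambda>_. False) U"
    proof eventually_elim
      case (elim t)
      then show ?case unfolding good_def by (metis norm_one less_irrefl)
    qed
    with U show False by (simp add: is_ultrafilter_def trivial_limit_def)
  qed
  with l show ?thesis by blast
qed

subsection \<open>Initial ideals of limits of point ideals\<close>

definition Mon :: "nat \<Rightarrow> nat \<Rightarrow> (nat \<Rightarrow>\<^sub>0 nat) set" where
  "Mon n k = {u. Poly_Mapping.keys u \<subseteq> {..n} \<and> (\<Sum>i\<le>n. Poly_Mapping.lookup u i) = k}"

lemma finite_Mon: "finite (Mon n k)"
proof (rule finite_imageD)
  have "(\<lambda>u. restrict (Poly_Mapping.lookup u) {..n}) ` Mon n k \<subseteq> PiE {..n} (\<lambda>_. {..k})"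
  proof (clarsimp simp: Mon_def)
    fix u :: "nat \<Rightarrow>\<^sub>0 nat" and i assume "i \<le> n"
    then show "Poly_Mapping.lookup u i \<le> (\<Sum>i\<le>n. Poly_Mapping.lookup u i)" by (intro member_le_sum) auto
  qed
  then show "finite ((\<lambda>u. restrict (Poly_Mapping.lookup u) {..n}) ` Mon n k)"
    by (rule finite_subset) (simp add: finite_PiE)
  show "inj_on (\<lambda>u. restrict (Poly_Mapping.lookup u) {..n}) (Mon n k)"
  proof (rule inj_onI, rule poly_mapping_eqI)
    fix u v :: "nat \<Rightarrow>\<^sub>0 nat" and i
    assume uv: "u \<in> Mon n k" "v \<in> Mon n k" "restrict (Poly_Mapping.lookup u) {..n} = restrict (Poly_Mapping.lookup v) {..n}"
    show "Poly_Mapping.lookup u i = Poly_Mapping.lookup v i"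
    proof (cases "i \<le> n")
      case True
      with fun_cong[OF uv(3), of i] show ?thesis by simp
    next
      case False
      then have "i \<notin> Poly_Mapping.keys u" "i \<notin> Poly_Mapping.keys v" using uv by (auto simp: Mon_def)
      then show ?thesis by (simp add: in_keys_iff)
    qed
  qed
qed

lemma Mon_add_single_iff:
  "u + Poly_Mapping.single i 1 \<in> Mon n (Suc k) \<longleftrightarrow> u \<in> Mon n k \<and> i \<le> n"
proof -
  have keys: "Poly_Mapping.keys (u + Poly_Mapping.single i 1) = insert i (Poly_Mapping.keys u)"
    by (auto simp: in_keys_iff lookup_add lookup_single when_def split: if_splits)
  have "(\<Sum>j\<le>n. Poly_Mapping.lookup (u + Poly_Mapping.single i 1) j) = Suc (\<Sum>j\<le>n. Poly_Mapping.lookup u j)" if "i \<le> n"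
  proof -
    have "(\<Sum>j\<le>n. Poly_Mapping.lookup (Poly_Mapping.single i (1::nat)) j) = 1"
      using that by (simp add: lookup_single when_def)
    then show ?thesis by (simp add: lookup_add sum.distrib)
  qed
  then show ?thesis by (auto simp: Mon_def keys simp del: One_nat_def)
qed

lemma Mon_add_single: "u \<in> Mon n k \<Longrightarrow> i \<le> n \<Longrightarrow> u + Poly_Mapping.single i 1 \<in> Mon n (Suc k)"
  by (simp only: Mon_add_single_iff)

definition mono_eval :: "nat \<Rightarrow> (nat \<Rightarrow> complex) \<Rightarrow> (nat \<Rightarrow>\<^sub>0 nat) \<Rightarrow> complex" where
  "mono_eval n x u = (\<Prod>i\<le>n. x i ^ Poly_Mapping.lookup u i)"

lemma mono_eval_add_single:
  assumes "i \<le> n"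
  shows "mono_eval n x (u + Poly_Mapping.single i 1) = x i * mono_eval n x u"
proof -
  have "(\<Prod>j\<le>n. x j ^ Poly_Mapping.lookup (Poly_Mapping.single i 1) j) = (\<Prod>j\<le>n. if j = i then x i else 1)"
    by (intro prod.cong) (auto simp: lookup_single when_def)
  then show ?thesis using assms
    by (simp add: mono_eval_def lookup_add power_add prod.distrib mult.commute)
qed

lemma mono_eval_eq_0:
  assumes "u \<in> Mon n k" "k \<ge> 1" "\<And>i. i \<le> n \<Longrightarrow> x i = 0"
  shows "mono_eval n x u = 0"
proof -
  obtain i where "i \<le> n" "Poly_Mapping.lookup u i \<noteq> 0"
    using assms(1,2) by (fastforce simp: Mon_def intro: ccontr)
  then show ?thesis using assms(3) by (force simp: mono_eval_def)
qed

lemma lookup_eq_minus_add_single: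
  assumes "Poly_Mapping.lookup u i \<ge> 1"
  shows "u = (u - Poly_Mapping.single i 1) + Poly_Mapping.single i (1::nat)"
  using assms by (intro poly_mapping_eqI) (auto simp: lookup_add lookup_minus lookup_single when_def)

text \<open>\<open>p t j\<close> holds the coefficients of the \<open>j\<close>-th linear form in
  the power sum with index \<open>t\<close>, read as a point of affine space; zero and proportional
  points are allowed.\<close>

locale point_family =
  fixes n r :: nat and p :: "'t \<Rightarrow> nat \<Rightarrow> nat \<Rightarrow> complex" and U :: "'t filter"
  assumes U: "is_ultrafilter U"
begin

definition vanishing :: "'t \<Rightarrow> nat \<Rightarrow> ((nat \<Rightarrow>\<^sub>0 nat) \<Rightarrow> complex) \<Rightarrow> bool" where
  "vanishing t k g \<longleftrightarrow> (\<forall>u. u \<notin> Mon n k \<longrightarrow> g u = 0) \<and>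
     (\<forall>j<r. (\<Sum>u\<in>Mon n k. g u * mono_eval n (p t j) u) = 0)"

text \<open>
  \<open>vanishing t k\<close> is the degree \<open>k\<close> part of the ideal of the points \<open>p t 0, \<dots>, p t (r - 1)\<close>,
  a polynomial being represented by its coefficient function. The limit along \<open>U\<close> replaces
  a limit point in a Grassmannian, and \<open>std k\<close> consists of the monomials of degree \<open>k\<close> outside
  the initial ideal of the limit, with respect to the order on \<^typ>\<open>nat \<Rightarrow>\<^sub>0 nat\<close>.
\<close>

definition limit_ideal :: "nat \<Rightarrow> ((nat \<Rightarrow>\<^sub>0 nat) \<Rightarrow> complex) \<Rightarrow> bool" where
  "limit_ideal k g \<longleftrightarrow> (\<exists>h. eventually (\<lambda>t. vanishing t k (h t)) U \<and> (\<forall>u. ((\<lambda>t. h t u) \<longlongrightarrow> g u) U))"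

definition std :: "nat \<Rightarrow> (nat \<Rightarrow>\<^sub>0 nat) set" where
  "std k = {u \<in> Mon n k. \<forall>g. limit_ideal k g \<longrightarrow> g u \<noteq> 0 \<longrightarrow> (\<exists>v>u. g v \<noteq> 0)}"

text \<open>Linear independence of the evaluations at the points of \<open>J\<close> as functionals
  on forms of degree \<open>k\<close>. The largest size of such a \<open>J\<close> within
  \<open>{..<r}\<close> is the Hilbert function of the points in degree \<open>k\<close>.\<close>

definition indep :: "'t \<Rightarrow> nat \<Rightarrow> nat set \<Rightarrow> bool" where
  "indep t k J \<longleftrightarrow> (\<forall>c. (\<forall>u\<in>Mon n k. (\<Sum>j\<in>J. c j * mono_eval n (p t j) u) = 0) \<longrightarrow> (\<forall>j\<in>J. c j = 0))"

lemma indepD: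
  assumes "indep t k J" "\<And>u. u \<in> Mon n k \<Longrightarrow> (\<Sum>j\<in>J. c j * mono_eval n (p t j) u) = 0" "j \<in> J"
  shows "c j = 0"
  using assms by (simp add: indep_def)

lemma U_ne_bot: "U \<noteq> bot"
  using U by (simp add: is_ultrafilter_def)

lemma std_subset: "std k \<subseteq> Mon n k"
  by (auto simp: std_def)

lemma finite_std: "finite (std k)"
  using std_subset finite_Mon by (rule finite_subset)

text \<open>The initial ideal is closed under multiplication by \<open>x_i\<close>: a limit form
  with leading monomial \<open>u\<close>, times \<open>x_i\<close>, is again a limit form, and its
  leading monomial is the product because the order is compatible with addition.\<close>

lemma std_downward:
  assumes "u + Poly_Mapping.single i 1 \<in> std (Suc k)"
  shows "u \<in> std k"
proof (rule ccontr)
  assume "u \<notin> std k"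
  have ui: "u \<in> Mon n k" "i \<le> n" using assms std_subset Mon_add_single_iff by blast+
  with \<open>u \<notin> std k\<close> obtain g where g: "limit_ideal k g" "g u \<noteq> 0" "\<And>v. v > u \<Longrightarrow> g v = 0"
    by (auto simp: std_def)
  let ?e = "Poly_Mapping.single i (1::nat)"
  \<comment> \<open>Multiplication by \<open>x_i\<close> on coefficient functions.\<close>
  define sh :: "((nat \<Rightarrow>\<^sub>0 nat) \<Rightarrow> complex) \<Rightarrow> (nat \<Rightarrow>\<^sub>0 nat) \<Rightarrow> complex"
    where "sh f w = (if Poly_Mapping.lookup w i \<ge> 1 then f (w - ?e) else 0)" for f w
  have sh_add: "sh f (v + ?e) = f v" for f v
    by (simp add: sh_def lookup_add)
  have sh_cases: "sh f w = 0 \<or> (\<exists>v. w = v + ?e)" for f w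
    using lookup_eq_minus_add_single[of w i] by (auto simp: sh_def)
  have van: "vanishing t (Suc k) (sh f)" if f: "vanishing t k f" for t f
  proof -
    have zero: "sh f w = 0" if "w \<notin> Mon n (Suc k)" for w
      using sh_cases[of f w] f that ui(2) Mon_add_single sh_add unfolding vanishing_def by metis
    have "(\<Sum>w\<in>Mon n (Suc k). sh f w * mono_eval n x w) = x i * (\<Sum>v\<in>Mon n k. f v * mono_eval n x v)" for x
    proof -
      have "(\<Sum>w\<in>Mon n (Suc k). sh f w * mono_eval n x w)
          = (\<Sum>w\<in>(\<lambda>v. v + ?e) ` Mon n k. sh f w * mono_eval n x w)"
      proof (rule sum.mono_neutral_right[OF finite_Mon])
        show "(\<lambda>v. v + ?e) ` Mon n k \<subseteq> Mon n (Suc k)" using ui(2) Mon_add_single by blast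
        show "\<forall>w\<in>Mon n (Suc k) - (\<lambda>v. v + ?e) ` Mon n k. sh f w * mono_eval n x w = 0"
          using sh_cases Mon_add_single_iff by (metis (no_types, lifting) DiffE image_eqI mult_zero_left)
      qed
      also have "\<dots> = (\<Sum>v\<in>Mon n k. f v * (x i * mono_eval n x v))"
        by (subst sum.reindex) (auto simp: sh_add mono_eval_add_single ui(2) simp del: One_nat_def)
      finally show ?thesis by (simp add: sum_distrib_left mult_ac)
    qed
    with zero f show ?thesis by (simp add: vanishing_def)
  qed
  obtain h where h: "eventually (\<lambda>t. vanishing t k (h t)) U" "\<And>u. ((\<lambda>t. h t u) \<longlongrightarrow> g u) U"
    using g(1) by (auto simp: limit_ideal_def)
  have "limit_ideal (Suc k) (sh g)"
    unfolding limit_ideal_def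
  proof (intro exI[of _ "\<lambda>t. sh (h t)"] conjI allI)
    show "eventually (\<lambda>t. vanishing t (Suc k) (sh (h t))) U"
      using h(1) by eventually_elim (rule van)
    show "((\<lambda>t. sh (h t) w) \<longlongrightarrow> sh g w) U" for w
      using h(2) by (auto simp: sh_def)
  qed
  moreover have "sh g (u + ?e) \<noteq> 0" using g(2) by (simp add: sh_add del: One_nat_def)
  ultimately obtain w where w: "w > u + ?e" "sh g w \<noteq> 0"
    using assms by (auto simp: std_def simp del: One_nat_def)
  then obtain v where v: "w = v + ?e" using sh_cases by blast
  with w(1) have "v > u" by (simp only: add_less_cancel_right)
  then show False using w(2) g(3) v by (simp add: sh_add del: One_nat_def)
qed

lemma indep_subset: "indep t k J \<Longrightarrow> J' \<subseteq> J \<Longrightarrow> finite J \<Longrightarrow> indep t k J'"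
  unfolding indep_def
proof (intro allI impI ballI)
  fix c j
  assume J: "\<forall>c. (\<forall>u\<in>Mon n k. (\<Sum>j\<in>J. c j * mono_eval n (p t j) u) = 0) \<longrightarrow> (\<forall>j\<in>J. c j = 0)"
    "J' \<subseteq> J" "finite J"
    and c: "\<forall>u\<in>Mon n k. (\<Sum>j\<in>J'. c j * mono_eval n (p t j) u) = 0" and j: "j \<in> J'"
  define c' where "c' j = (if j \<in> J' then c j else 0)" for j
  have "(\<Sum>j\<in>J. c' j * mono_eval n (p t j) u) = (\<Sum>j\<in>J'. c j * mono_eval n (p t j) u)" for u
    using J by (intro sum.mono_neutral_cong_right) (auto simp: c'_def)
  then have "\<forall>j\<in>J. c' j = 0" using J(1) c by simp
  then have "c' j = 0" using j J(2) by blast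
  then show "c j = 0" using j by (simp add: c'_def)
qed

text \<open>A maximal independent \<open>J\<close> has fewer elements than \<open>B\<close>, so some
  nonzero form supported on \<open>B\<close> vanishes at the points of \<open>J\<close>. By
  maximality, evaluation at any other point is a combination of those at \<open>J\<close>.\<close>

lemma exists_vanishing:
  assumes B: "B \<subseteq> Mon n k" and no: "\<And>J. J \<subseteq> {..<r} \<Longrightarrow> indep t k J \<Longrightarrow> card J \<noteq> card B"
  shows "\<exists>g. (\<exists>b\<in>B. g b \<noteq> 0) \<and> (\<forall>u. u \<notin> B \<longrightarrow> g u = 0) \<and> vanishing t k g"
proof -
  define \<J> where "\<J> = {J. J \<subseteq> {..<r} \<and> indep t k J}"
  have "finite \<J>" by (rule finite_subset[of _ "Pow {..<r}"]) (auto simp: \<J>_def)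
  moreover have "{} \<in> \<J>" by (simp add: \<J>_def indep_def)
  ultimately obtain J where J: "J \<in> \<J>" and max: "\<And>J'. J' \<in> \<J> \<Longrightarrow> J \<subseteq> J' \<Longrightarrow> J' = J"
    using finite_has_maximal[of \<J>] by (metis empty_iff)
  have finJ: "finite J" using J finite_subset by (auto simp: \<J>_def)
  have finB: "finite B" using B finite_Mon finite_subset by blast
  have "card J < card B"
  proof (rule ccontr)
    assume "\<not> card J < card B"
    then obtain J' where "J' \<subseteq> J" "card J' = card B"
      by (metis not_less obtain_subset_with_card_n)
    moreover have "J \<subseteq> {..<r}" "indep t k J" using J by (auto simp: \<J>_def)
    ultimately show False using no[of J'] indep_subset finJ by blast
  qed
  from homogeneous_system_nontrivial[OF finJ finB this, of "\<lambda>j. mono_eval n (p t j)"]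
  obtain g where g: "\<exists>b\<in>B. g b \<noteq> 0" "\<And>j. j \<in> J \<Longrightarrow> (\<Sum>b\<in>B. g b * mono_eval n (p t j) b) = 0"
    by auto
  define g' where "g' u = (if u \<in> B then g u else 0)" for u
  define \<phi> where "\<phi> j = (\<Sum>u\<in>Mon n k. g' u * mono_eval n (p t j) u)" for j
  have \<phi>J: "\<phi> j = 0" if "j \<in> J" for j
  proof -
    have "\<phi> j = (\<Sum>b\<in>B. g b * mono_eval n (p t j) b)" unfolding \<phi>_def
      using B finite_Mon by (intro sum.mono_neutral_cong_right) (auto simp: g'_def)
    then show ?thesis using g that by simp
  qed
  have "\<phi> j = 0" if j: "j < r" for j
  proof (cases "j \<in> J")
    case False
    have "insert j J \<notin> \<J>" using max[of "insert j J"] False by auto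
    then have "\<not> indep t k (insert j J)" using J j by (auto simp: \<J>_def)
    then obtain c j0 where c: "\<And>u. u \<in> Mon n k \<Longrightarrow> (\<Sum>i\<in>insert j J. c i * mono_eval n (p t i) u) = 0"
      and j0: "j0 \<in> insert j J" "c j0 \<noteq> 0"
      by (auto simp: indep_def)
    \<comment> \<open>Hence the relation can be solved for the evaluation at point
      \<open>j\<close>.\<close>
    have "c j \<noteq> 0"
    proof
      assume "c j = 0"
      then have "\<forall>u\<in>Mon n k. (\<Sum>i\<in>J. c i * mono_eval n (p t i) u) = 0"
        using c finJ False by simp
      then have "\<forall>i\<in>J. c i = 0" using J by (auto simp: \<J>_def indep_def)
      with \<open>c j = 0\<close> j0 show False by auto
    qed
    have "0 = (\<Sum>u\<in>Mon n k. g' u * (\<Sum>i\<in>insert j J. c i * mono_eval n (p t i) u))"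
      using c by simp
    also have "\<dots> = (\<Sum>i\<in>insert j J. c i * \<phi> i)"
      unfolding \<phi>_def sum_distrib_left by (subst sum.swap) (simp add: mult_ac)
    also have "\<dots> = c j * \<phi> j" using finJ False \<phi>J by simp
    finally show ?thesis using \<open>c j \<noteq> 0\<close> by simp
  qed (rule \<phi>J)
  then have "vanishing t k g'" using B by (auto simp: vanishing_def \<phi>_def g'_def)
  moreover have "\<exists>b\<in>B. g' b \<noteq> 0" using g(1) by (auto simp: g'_def)
  ultimately show ?thesis by (intro exI[of _ g']) (auto simp: g'_def)
qed

lemma vanishing_scale: "vanishing t k g \<Longrightarrow> vanishing t k (\<lambda>u. c * g u)"
  by (auto simp: vanishing_def mult.assoc sum_distrib_left[symmetric])

text \<open>Otherwise, eventually along \<open>U\<close>, a nonzero form supported on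
  \<open>std k\<close> vanishes at all the points. The normalised limit is a nonzero element of the
  limit ideal whose leading monomial is standard, which is impossible.\<close>

lemma eventually_indep_card_std:
  "eventually (\<lambda>t. \<exists>J\<subseteq>{..<r}. card J = card (std k) \<and> indep t k J) U"
proof (rule ccontr)
  assume "\<not> ?thesis"
  then have ev: "eventually (\<lambda>t. \<not> (\<exists>J\<subseteq>{..<r}. card J = card (std k) \<and> indep t k J)) U"
    using ultrafilter_not_eventually[OF U] by blast
  define good where "good t g \<longleftrightarrow> (\<exists>b\<in>std k. g b \<noteq> 0) \<and> (\<forall>u. u \<notin> std k \<longrightarrow> g u = 0) \<and> vanishing t k g"
    for t g
  define g where "g t = (SOME g. good t g)" for t
  have good: "eventually (\<lambda>t. good t (g t)) U"
    using ev
  proof eventually_elim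
    case (elim t)
    have "\<exists>g. good t g" unfolding good_def
      by (rule exists_vanishing[OF std_subset]) (use elim in auto)
    then show ?case unfolding g_def by (rule someI_ex)
  qed
  have "eventually (\<lambda>t. \<exists>b\<in>std k. g t b \<noteq> 0) U"
    using good by eventually_elim (simp add: good_def)
  from ultrafilter_limit_normalized[OF U finite_std this] obtain c l
    where l: "\<And>b. b \<in> std k \<Longrightarrow> ((\<lambda>t. c t * g t b) \<longlongrightarrow> l b) U" "\<exists>b\<in>std k. l b \<noteq> 0"
    by blast
  define l' where "l' u = (if u \<in> std k then l u else 0)" for u
  have "limit_ideal k l'"
    unfolding limit_ideal_def
  proof (intro exI[of _ "\<lambda>t u. c t * g t u"] conjI allI)
    show "eventually (\<lambda>t. vanishing t k (\<lambda>u. c t * g t u)) U"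
      using good by eventually_elim (simp add: good_def vanishing_scale)
    show "((\<lambda>t. c t * g t u) \<longlongrightarrow> l' u) U" for u
    proof (cases "u \<in> std k")
      case True
      then show ?thesis using l(1) by (simp add: l'_def)
    next
      case False
      have "eventually (\<lambda>t. c t * g t u = l' u) U"
        using good by eventually_elim (use False in \<open>simp add: good_def l'_def\<close>)
      then show ?thesis by (rule tendsto_eventually)
    qed
  qed
  define T where "T = {u \<in> std k. l u \<noteq> 0}"
  have T: "finite T" "T \<noteq> {}" using l(2) finite_std by (auto simp: T_def)
  then have "Max T \<in> T" by (rule Max_in)
  then have "Max T \<in> std k" "l' (Max T) \<noteq> 0" by (auto simp: T_def l'_def)
  with \<open>limit_ideal k l'\<close> obtain v where "v > Max T" "l' v \<noteq> 0" by (auto simp: std_def)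
  moreover from this have "v \<in> T" by (auto simp: T_def l'_def split: if_splits)
  ultimately show False using T Max_ge not_le by blast
qed

text \<open>
  With fewer than \<open>s\<close> standard monomials, some combination of the evaluations at \<open>s\<close> points
  kills all of them. Its normalised limit annihilates the limit ideal, so the smallest monomial
  on which it does not vanish cannot be a leading one.
\<close>

lemma card_std_ge:
  assumes ev: "eventually (\<lambda>t. \<exists>J\<subseteq>{..<r}. card J = s \<and> indep t k J) U"
  shows "s \<le> card (std k)"
proof (rule ccontr)
  assume "\<not> ?thesis"
  then have less: "card (std k) < s" by simp
  \<comment> \<open>\<open>w\<close> encodes a functional on forms of degree \<open>k\<close> by its
    values on monomials.\<close>
  define good where "good t w \<longleftrightarrow> (\<exists>u\<in>Mon n k. w u \<noteq> 0) \<and> (\<forall>u\<in>std k. w u = 0) \<and>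
      (\<forall>g. vanishing t k g \<longrightarrow> (\<Sum>u\<in>Mon n k. g u * w u) = 0)" for t and w :: "(nat \<Rightarrow>\<^sub>0 nat) \<Rightarrow> complex"
  define w where "w t = (SOME w. good t w)" for t
  have good: "eventually (\<lambda>t. good t (w t)) U"
    using ev
  proof eventually_elim
    case (elim t)
    then obtain J where J: "J \<subseteq> {..<r}" "card J = s" "indep t k J" by auto
    have "finite J" using J(1) finite_subset by blast
    moreover have "card (std k) < card J" using less J by simp
    ultimately obtain c where c: "\<exists>j\<in>J. c j \<noteq> 0"
      "\<And>u. u \<in> std k \<Longrightarrow> (\<Sum>j\<in>J. c j * mono_eval n (p t j) u) = 0"
      using homogeneous_system_nontrivial[OF finite_std, of J k "\<lambda>u j. mono_eval n (p t j) u"] by auto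
    let ?w = "\<lambda>u. \<Sum>j\<in>J. c j * mono_eval n (p t j) u"
    have "(\<Sum>u\<in>Mon n k. g u * ?w u) = 0" if g: "vanishing t k g" for g
    proof -
      have "(\<Sum>u\<in>Mon n k. g u * ?w u) = (\<Sum>j\<in>J. c j * (\<Sum>u\<in>Mon n k. g u * mono_eval n (p t j) u))"
        unfolding sum_distrib_left by (subst sum.swap) (simp add: mult_ac)
      also have "\<dots> = 0" using g J(1) by (intro sum.neutral) (auto simp: vanishing_def)
      finally show ?thesis .
    qed
    moreover have "\<exists>u\<in>Mon n k. ?w u \<noteq> 0" using c(1) J(3) unfolding indep_def by blast
    ultimately have "good t ?w" using c(2) by (simp add: good_def)
    then show ?case unfolding w_def by (rule someI[of "good t"])
  qed
  have "eventually (\<lambda>t. \<exists>u\<in>Mon n k. w t u \<noteq> 0) U"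
    using good by eventually_elim (simp add: good_def)
  from ultrafilter_limit_normalized[OF U finite_Mon this] obtain c l
    where l: "\<And>u. u \<in> Mon n k \<Longrightarrow> ((\<lambda>t. c t * w t u) \<longlongrightarrow> l u) U" "\<exists>u\<in>Mon n k. l u \<noteq> 0"
    by blast
  have l_std: "l u = 0" if u: "u \<in> std k" for u
  proof (rule tendsto_unique[OF U_ne_bot l(1)])
    show "u \<in> Mon n k" using u std_subset by blast
    have "eventually (\<lambda>t. c t * w t u = 0) U"
      using good by eventually_elim (use u in \<open>simp add: good_def\<close>)
    then show "((\<lambda>t. c t * w t u) \<longlongrightarrow> 0) U" by (rule tendsto_eventually)
  qed
  have l_ann: "(\<Sum>u\<in>Mon n k. g u * l u) = 0" if g: "limit_ideal k g" for g
  proof -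
    obtain h where h: "eventually (\<lambda>t. vanishing t k (h t)) U" "\<And>u. ((\<lambda>t. h t u) \<longlongrightarrow> g u) U"
      using g by (auto simp: limit_ideal_def)
    have "((\<lambda>t. \<Sum>u\<in>Mon n k. h t u * (c t * w t u)) \<longlongrightarrow> (\<Sum>u\<in>Mon n k. g u * l u)) U"
      by (intro tendsto_sum tendsto_mult h(2) l(1))
    moreover have "eventually (\<lambda>t. (\<Sum>u\<in>Mon n k. h t u * (c t * w t u)) = 0) U"
      using h(1) good
    proof eventually_elim
      case (elim t)
      have "(\<Sum>u\<in>Mon n k. h t u * (c t * w t u)) = c t * (\<Sum>u\<in>Mon n k. h t u * w t u)"
        by (simp add: sum_distrib_left mult_ac)
      with elim show ?case by (simp add: good_def)
    qed
    ultimately show ?thesis by (intro tendsto_unique[OF U_ne_bot _ tendsto_eventually])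
  qed
  define T where "T = {u \<in> Mon n k. l u \<noteq> 0}"
  have T: "finite T" "T \<noteq> {}" using l(2) finite_Mon by (auto simp: T_def)
  then have m: "Min T \<in> T" by (rule Min_in)
  then have "Min T \<in> Mon n k" "Min T \<notin> std k" using l_std by (auto simp: T_def)
  then obtain g where g: "limit_ideal k g" "g (Min T) \<noteq> 0" "\<And>v. v > Min T \<Longrightarrow> g v = 0"
    by (auto simp: std_def)
  \<comment> \<open>Above \<open>Min T\<close> the form \<open>g\<close> has no monomials, below it
    \<open>l\<close> vanishes; the pairing reduces to one nonzero term.\<close>
  have "g v * l v = 0" if "v \<in> Mon n k - {Min T}" for v
  proof (cases "v > Min T")
    case False
    then have "v < Min T" using that by auto
    then have "v \<notin> T" using T Min_le not_le by blast
    then show ?thesis using that by (auto simp: T_def)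
  qed (simp add: g(3))
  then have "(\<Sum>u\<in>Mon n k. g u * l u) = g (Min T) * l (Min T)"
    using sum.remove[OF finite_Mon \<open>Min T \<in> Mon n k\<close>, of "\<lambda>u. g u * l u"] by (simp add: sum.neutral)
  moreover have "l (Min T) \<noteq> 0" using m by (auto simp: T_def)
  ultimately show False using l_ann[OF g(1)] g(2) by simp
qed

lemma card_std_le: "card (std k) \<le> r"
proof -
  have "eventually (\<lambda>t. card (std k) \<le> r) U"
    using eventually_indep_card_std[of k]
    by eventually_elim (metis card_lessThan card_mono finite_lessThan)
  then show ?thesis using U_ne_bot by (simp add: eventually_const)
qed

text \<open>Applied to multiples of \<open>x_i\<close>, a relation in degree \<open>k + 1\<close>
  becomes one in degree \<open>k\<close> with coefficients \<open>c j * p t j i\<close>. So a point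
  with \<open>c j \<noteq> 0\<close> is zero, and evaluation at it vanishes in degree
  \<open>k \<ge> 1\<close>, against independence.\<close>

lemma indep_Suc:
  assumes J: "indep t k J" and k: "k \<ge> 1" and fin: "finite J"
  shows "indep t (Suc k) J"
  unfolding indep_def
proof (intro allI impI ballI, rule ccontr)
  fix c j
  assume c: "\<forall>u\<in>Mon n (Suc k). (\<Sum>j\<in>J. c j * mono_eval n (p t j) u) = 0" and j: "j \<in> J" "c j \<noteq> 0"
  have "p t j i = 0" if i: "i \<le> n" for i
  proof -
    have "(\<Sum>j\<in>J. (c j * p t j i) * mono_eval n (p t j) u) = 0" if "u \<in> Mon n k" for u
      using bspec[OF c Mon_add_single[OF that i]] i
      by (simp add: mono_eval_add_single mult_ac del: One_nat_def)
    from indepD[of t k J "\<lambda>j. c j * p t j i", OF J this j(1)] show ?thesis using j(2) by simp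
  qed
  then have z: "mono_eval n (p t j) u = 0" if "u \<in> Mon n k" for u
    using mono_eval_eq_0 that k by blast
  define c' :: "nat \<Rightarrow> complex" where "c' i = (if i = j then 1 else 0)" for i
  have "(\<Sum>i\<in>J. c' i * mono_eval n (p t i) u) = 0" if "u \<in> Mon n k" for u
    using z[OF that] by (intro sum.neutral) (auto simp: c'_def)
  from indepD[of t k J c', OF J this j(1)] show False by (simp add: c'_def)
qed

lemma card_std_mono:
  assumes "k \<ge> 1"
  shows "card (std k) \<le> card (std (Suc k))"
proof (rule card_std_ge)
  show "eventually (\<lambda>t. \<exists>J\<subseteq>{..<r}. card J = card (std k) \<and> indep t (Suc k) J) U"
    using eventually_indep_card_std[of k]
  proof eventually_elim
    case (elim t)
    then show ?case using indep_Suc[OF _ assms] finite_subset[OF _ finite_lessThan] by metis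
  qed
qed

text \<open>Apolarity: as a limit of sums of evaluations, \<open>\<Phi>\<close> pairs to zero with
  the limit ideal. Being supported on \<open>a\<close> alone, it forces every limit form to have
  coefficient zero at \<open>a\<close>.\<close>

lemma apolar_in_std:
  assumes a: "a \<in> Mon n d" "\<Phi> a \<noteq> 0" "\<And>u. u \<in> Mon n d \<Longrightarrow> u \<noteq> a \<Longrightarrow> \<Phi> u = 0"
    and lim: "\<And>u. u \<in> Mon n d \<Longrightarrow> ((\<lambda>t. \<Sum>j<r. mono_eval n (p t j) u) \<longlongrightarrow> \<Phi> u) U"
  shows "a \<in> std d"
proof -
  have "g a = 0" if g: "limit_ideal d g" for g
  proof -
    obtain h where h: "eventually (\<lambda>t. vanishing t d (h t)) U" "\<And>u. ((\<lambda>t. h t u) \<longlongrightarrow> g u) U"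
      using g by (auto simp: limit_ideal_def)
    have "((\<lambda>t. \<Sum>u\<in>Mon n d. h t u * (\<Sum>j<r. mono_eval n (p t j) u)) \<longlongrightarrow> (\<Sum>u\<in>Mon n d. g u * \<Phi> u)) U"
      by (intro tendsto_sum tendsto_mult h(2) lim)
    moreover have "eventually (\<lambda>t. (\<Sum>u\<in>Mon n d. h t u * (\<Sum>j<r. mono_eval n (p t j) u)) = 0) U"
      using h(1)
    proof eventually_elim
      case (elim t)
      have "(\<Sum>u\<in>Mon n d. h t u * (\<Sum>j<r. mono_eval n (p t j) u))
          = (\<Sum>j<r. \<Sum>u\<in>Mon n d. h t u * mono_eval n (p t j) u)"
        unfolding sum_distrib_left by (rule sum.swap)
      with elim show ?case by (simp add: vanishing_def)
    qed
    ultimately have "(\<Sum>u\<in>Mon n d. g u * \<Phi> u) = 0"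
      by (intro tendsto_unique[OF U_ne_bot _ tendsto_eventually])
    also have "(\<Sum>u\<in>Mon n d. g u * \<Phi> u) = g a * \<Phi> a"
      using a finite_Mon by (subst sum.remove[of _ a]) auto
    finally show ?thesis using a(2) by simp
  qed
  then show ?thesis using a(1) by (auto simp: std_def)
qed

end

subsection \<open>Order ideals containing a large box\<close>

definition exps :: "nat \<Rightarrow> (nat \<Rightarrow> nat) \<Rightarrow> nat \<Rightarrow>\<^sub>0 nat" where
  "exps n f = (\<Sum>i\<le>n. Poly_Mapping.single i (f i))"

lemma lookup_exps: "Poly_Mapping.lookup (exps n f) i = (if i \<le> n then f i else 0)"
  by (simp add: exps_def lookup_sum lookup_single when_def)

definition divisors :: "(nat \<Rightarrow>\<^sub>0 nat) \<Rightarrow> (nat \<Rightarrow>\<^sub>0 nat) set" where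
  "divisors u = {x. \<forall>i. Poly_Mapping.lookup x i \<le> Poly_Mapping.lookup u i}"

lemma divisors_exps_bij: "bij_betw (exps n) (PiE {..n} (\<lambda>i. {..f i})) (divisors (exps n f))"
proof (rule bij_betw_byWitness[where f' = "\<lambda>x. restrict (Poly_Mapping.lookup x) {..n}"])
  show "\<forall>g\<in>PiE {..n} (\<lambda>i. {..f i}). restrict (Poly_Mapping.lookup (exps n g)) {..n} = g"
    by (auto simp: lookup_exps fun_eq_iff PiE_def extensional_def)
  show "\<forall>x\<in>divisors (exps n f). exps n (restrict (Poly_Mapping.lookup x) {..n}) = x"
  proof
    fix x assume x: "x \<in> divisors (exps n f)"
    have "Poly_Mapping.lookup x i \<le> (if i \<le> n then f i else 0)" for i using x by (auto simp: divisors_def lookup_exps)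
    then have "Poly_Mapping.lookup x i = 0" if "\<not> i \<le> n" for i using that by (metis le_zero_eq)
    then show "exps n (restrict (Poly_Mapping.lookup x) {..n}) = x"
      by (intro poly_mapping_eqI) (simp add: lookup_exps)
  qed
  show "exps n ` PiE {..n} (\<lambda>i. {..f i}) \<subseteq> divisors (exps n f)"
    by (auto simp: divisors_def lookup_exps PiE_def Pi_def)
  show "(\<lambda>x. restrict (Poly_Mapping.lookup x) {..n}) ` divisors (exps n f) \<subseteq> PiE {..n} (\<lambda>i. {..f i})"
    by (auto simp: divisors_def lookup_exps) (metis lookup_exps)
qed

lemma card_divisors_exps: "card (divisors (exps n f)) = (\<Prod>i\<le>n. f i + 1)"
  using bij_betw_same_card[OF divisors_exps_bij, of n f] by (simp add: card_PiE)

lemma finite_divisors_exps: "finite (divisors (exps n f))"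
  using bij_betw_finite[OF divisors_exps_bij, of n f] by (simp add: finite_PiE)

text \<open>The degree of \<open>u\<close> exceeds \<open>c\<close>: either the exponent at
  \<open>i\<close> is above \<open>c\<close> and \<open>x_i\<close> is removed, or another variable
  occurs and is removed.\<close>

lemma Mon_split_above:
  assumes u: "u \<in> Mon n (Suc k)" and c: "c \<le> Poly_Mapping.lookup u i" "c \<le> k"
  shows "\<exists>j v. u = v + Poly_Mapping.single j 1 \<and> c \<le> Poly_Mapping.lookup v i \<and> v \<in> Mon n k \<and> j \<le> n"
proof -
  have "\<exists>j\<le>n. Poly_Mapping.lookup u j \<ge> 1 \<and> c \<le> Poly_Mapping.lookup (u - Poly_Mapping.single j 1) i"
  proof (cases "c < Poly_Mapping.lookup u i")
    case True
    then have "i \<in> Poly_Mapping.keys u" by (simp add: in_keys_iff)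
    then have "i \<le> n" using u by (auto simp: Mon_def)
    then show ?thesis using True by (intro exI[of _ i]) (auto simp: lookup_minus)
  next
    case False
    then have eq: "Poly_Mapping.lookup u i = c" using c by simp
    have "\<exists>j\<in>{..n} - {i}. Poly_Mapping.lookup u j \<noteq> 0"
    proof (rule ccontr)
      assume "\<not> ?thesis"
      then have "(\<Sum>j\<le>n. Poly_Mapping.lookup u j) \<le> (\<Sum>j\<le>n. if j = i then c else 0)"
        using eq by (intro sum_mono) auto
      also have "\<dots> \<le> c" by (simp add: sum.delta)
      finally show False using u c(2) by (simp add: Mon_def)
    qed
    then obtain j where "j \<le> n" "j \<noteq> i" "Poly_Mapping.lookup u j \<noteq> 0" by auto
    then show ?thesis using eq
      by (intro exI[of _ j]) (auto simp: lookup_minus lookup_single when_def)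
  qed
  then obtain j where j: "j \<le> n" "Poly_Mapping.lookup u j \<ge> 1" "c \<le> Poly_Mapping.lookup (u - Poly_Mapping.single j 1) i"
    by blast
  have eq: "u = (u - Poly_Mapping.single j 1) + Poly_Mapping.single j 1"
    using j(2) by (rule lookup_eq_minus_add_single)
  then have "u - Poly_Mapping.single j 1 \<in> Mon n k" using u Mon_add_single_iff by metis
  with eq j show ?thesis by blast
qed

locale order_ideal =
  fixes n :: nat and N :: "(nat \<Rightarrow>\<^sub>0 nat) set"
  assumes keys: "\<And>u. u \<in> N \<Longrightarrow> Poly_Mapping.keys u \<subseteq> {..n}"
    and down: "\<And>u i. u + Poly_Mapping.single i 1 \<in> N \<Longrightarrow> u \<in> N"
begin

lemma downward:
  assumes "v \<in> N" "\<And>i. Poly_Mapping.lookup u i \<le> Poly_Mapping.lookup v i"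
  shows "u \<in> N"
proof -
  have *: "u + w \<in> N \<Longrightarrow> w \<in> Mon n k \<Longrightarrow> u \<in> N" for w k
  proof (induction k arbitrary: w)
    case 0
    then have "Poly_Mapping.lookup w i = 0" for i
      by (cases "i \<le> n") (auto simp: Mon_def in_keys_iff)
    then have "w = 0" by (intro poly_mapping_eqI) simp
    with 0 show ?case by simp
  next
    case (Suc k)
    from Mon_split_above[OF Suc.prems(2), of 0 0] obtain j v
      where v: "w = v + Poly_Mapping.single j 1" "v \<in> Mon n k" by auto
    then have "u + v \<in> N" using Suc.prems(1) down[of "u + v" j] by (simp add: add.assoc)
    with Suc.IH v(2) show ?case by blast
  qed
  have "v = u + (v - u)"
    using assms(2) by (intro poly_mapping_eqI) (simp add: lookup_add lookup_minus)
  moreover have "Poly_Mapping.keys (v - u) \<subseteq> Poly_Mapping.keys v"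
    by (auto simp: in_keys_iff lookup_minus)
  then have "v - u \<in> Mon n (\<Sum>i\<le>n. Poly_Mapping.lookup (v - u) i)"
    using keys[OF assms(1)] by (auto simp: Mon_def)
  ultimately show ?thesis using * assms(1) by metis
qed

lemma divisor_above:
  assumes "u \<in> N" "u \<in> Mon n D" "c \<le> Poly_Mapping.lookup u i" "c \<le> k" "k \<le> D"
  shows "\<exists>v\<in>N \<inter> Mon n k. c \<le> Poly_Mapping.lookup v i"
  using assms(5,1-4)
proof (induction D arbitrary: u rule: dec_induct)
  case base
  then show ?case by auto
next
  case (step D)
  then have "c \<le> D" by simp
  from Mon_split_above[OF step.prems(2,3) this] obtain j v
    where v: "u = v + Poly_Mapping.single j 1" "c \<le> Poly_Mapping.lookup v i" "v \<in> Mon n D" by blast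
  then have "v \<in> N" using step.prems(1) down by blast
  with step.IH v step.prems show ?case by blast
qed

end

section \<open>Counting monomials by degree in an order ideal with nondecreasing counts\<close>

text \<open>Abstracts from the standard monomials: \<open>top_in\<close> will come from apolarity,
  \<open>mono\<close> from the growth of the Hilbert function of points.\<close>

locale large_box = order_ideal +
  fixes a :: "nat \<Rightarrow> nat"
  assumes n: "n \<ge> 1"
    and pos: "\<And>i. i \<le> n \<Longrightarrow> 1 \<le> a i"
    and le_last: "\<And>i. i \<le> n \<Longrightarrow> a i \<le> a n"
    and last_ge: "(\<Sum>i<n. a i) \<le> a n + 2"
    and top_in: "exps n a \<in> N"
    and mono: "\<And>k. k \<ge> 1 \<Longrightarrow> card (N \<inter> Mon n k) \<le> card (N \<inter> Mon n (Suc k))"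
begin

definition S where "S = (\<Sum>i<n. a i)"
definition d where "d = (\<Sum>i\<le>n. a i)"
definition P where "P = (\<Prod>i<n. a i + 1)"

definition outer :: "nat \<Rightarrow> (nat \<Rightarrow>\<^sub>0 nat) set" where
  "outer k = (N \<inter> Mon n k) - divisors (exps n a)"

definition face :: "nat \<Rightarrow> (nat \<Rightarrow>\<^sub>0 nat) set" where
  "face k = divisors (exps n (a(k := 0)))"

text \<open>
  \<open>lift k D\<close> homogenises to degree \<open>D\<close> with the variable \<open>x\<^sub>k\<close>, for arguments of degree at
  most \<open>D\<close>.
\<close>

definition lift :: "nat \<Rightarrow> nat \<Rightarrow> (nat \<Rightarrow>\<^sub>0 nat) \<Rightarrow> nat \<Rightarrow>\<^sub>0 nat" where
  "lift k D x = x + Poly_Mapping.single k (D - (\<Sum>i\<le>n. Poly_Mapping.lookup x i))"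

lemma d_eq: "d = S + a n"
  unfolding d_def S_def using lessThan_Suc_atMost[of n, symmetric] by simp

lemma finite_slice: "finite (N \<inter> Mon n k)"
  using finite_Mon by blast

lemma mono_le:
  assumes "1 \<le> k" "k \<le> D"
  shows "card (N \<inter> Mon n k) \<le> card (N \<inter> Mon n D)"
  using assms(2)
proof (induction D rule: dec_induct)
  case (step D)
  then show ?case using mono[of D] assms(1) by linarith
qed simp

lemma box_subset: "divisors (exps n a) \<subseteq> N"
  using downward[OF top_in] by (auto simp: divisors_def)

lemma face_le: "x \<in> face k \<Longrightarrow> Poly_Mapping.lookup x i \<le> (if i \<le> n \<and> i \<noteq> k then a i else 0)"
  unfolding face_def divisors_def by (auto simp: lookup_exps split: if_splits dest: spec[of _ i])

lemma face_keys: "x \<in> face k \<Longrightarrow> Poly_Mapping.keys x \<subseteq> {..n}"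
proof
  fix i assume "x \<in> face k" "i \<in> Poly_Mapping.keys x"
  then show "i \<in> {..n}" using face_le[of x k i] by (auto simp: in_keys_iff split: if_splits)
qed

lemma finite_face: "finite (face k)"
  unfolding face_def by (rule finite_divisors_exps)

text \<open>Dropping the factor of index \<open>k\<close> or that of index \<open>n\<close> from the
  full product leaves the same value, as \<open>a k = a n\<close>.\<close>

lemma card_face:
  assumes "k \<le> n" "a k = a n"
  shows "card (face k) = P"
proof -
  have *: "(\<Prod>i\<le>n. (a(j := 0)) i + 1) * (a j + 1) = (\<Prod>i\<le>n. a i + 1)" if "j \<le> n" for j
  proof -
    have "(\<Prod>i\<le>n. (a(j := 0)) i + 1) = (\<Prod>i\<in>{..n} - {j}. a i + 1)"
      using that by (subst prod.remove[of _ j]) (auto intro!: prod.cong)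
    then show ?thesis using that by (simp add: prod.remove[of "{..n}" j])
  qed
  have "(\<Prod>i\<le>n. a i + 1) = P * (a n + 1)"
    unfolding P_def using lessThan_Suc_atMost[of n, symmetric] by simp
  with *[OF assms(1)] assms(2) have "(\<Prod>i\<le>n. (a(k := 0)) i + 1) * (a n + 1) = P * (a n + 1)"
    by simp
  then have "(\<Prod>i\<le>n. (a(k := 0)) i + 1) = P" by (simp del: mult_Suc_right add: mult_cancel2)
  then show ?thesis unfolding face_def card_divisors_exps .
qed

lemma face_degree:
  assumes "x \<in> face k" "k \<le> n" "a k = a n"
  shows "(\<Sum>i\<le>n. Poly_Mapping.lookup x i) \<le> S"
    and "(\<Sum>i\<le>n. Poly_Mapping.lookup x i) = S \<Longrightarrow> x = exps n (a(k := 0))"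
proof -
  have le: "Poly_Mapping.lookup x i \<le> (a(k := 0)) i" if "i \<le> n" for i
    using face_le[OF assms(1), of i] that by auto
  have sum: "(\<Sum>i\<le>n. (a(k := 0)) i) = S"
  proof -
    have "d = a k + (\<Sum>i\<in>{..n} - {k}. a i)"
      unfolding d_def using assms(2) by (simp add: sum.remove[of "{..n}" k])
    moreover have "(\<Sum>i\<le>n. (a(k := 0)) i) = (\<Sum>i\<in>{..n} - {k}. a i)"
      using assms(2) by (subst sum.remove[of _ k]) (auto intro!: sum.cong)
    ultimately show ?thesis using d_eq assms(3) by simp
  qed
  show "(\<Sum>i\<le>n. Poly_Mapping.lookup x i) \<le> S" unfolding sum[symmetric] using le by (intro sum_mono) auto
  assume eq: "(\<Sum>i\<le>n. Poly_Mapping.lookup x i) = S"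
  have "Poly_Mapping.lookup x i = (a(k := 0)) i" if "i \<le> n" for i
  proof (rule ccontr)
    assume "Poly_Mapping.lookup x i \<noteq> (a(k := 0)) i"
    with le[OF that] have "Poly_Mapping.lookup x i < (a(k := 0)) i" by simp
    then have "\<exists>i\<in>{..n}. Poly_Mapping.lookup x i < (a(k := 0)) i" using that by blast
    then have "(\<Sum>i\<le>n. Poly_Mapping.lookup x i) < (\<Sum>i\<le>n. (a(k := 0)) i)"
      by (intro sum_strict_mono_ex1[OF finite_atMost]) (use le in blast)+
    with eq sum show False by simp
  qed
  moreover have "Poly_Mapping.lookup x i = 0" if "\<not> i \<le> n" for i
    using face_le[OF assms(1), of i] that by simp
  ultimately show "x = exps n (a(k := 0))" by (intro poly_mapping_eqI) (simp add: lookup_exps)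
qed

lemma lookup_lift:
  "Poly_Mapping.lookup (lift k D x) i = Poly_Mapping.lookup x i + (if i = k then D - (\<Sum>i\<le>n. Poly_Mapping.lookup x i) else 0)"
  by (auto simp: lift_def lookup_add lookup_single when_def)

lemma lift_Mon:
  assumes "x \<in> face k" "k \<le> n" "(\<Sum>i\<le>n. Poly_Mapping.lookup x i) \<le> D"
  shows "lift k D x \<in> Mon n D"
proof -
  have "Poly_Mapping.keys (lift k D x) \<subseteq> {..n}"
    using keys_add[of x "Poly_Mapping.single k (D - (\<Sum>i\<le>n. Poly_Mapping.lookup x i))"]
      face_keys[OF assms(1)] assms(2) by (auto simp: lift_def split: if_splits)
  then show ?thesis using assms by (simp add: Mon_def lookup_lift sum.distrib)
qed

lemma inj_lift: "inj_on (lift k D) (face k)"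
proof (rule inj_onI, rule poly_mapping_eqI)
  fix x y i assume xy: "x \<in> face k" "y \<in> face k" "lift k D x = lift k D y"
  show "Poly_Mapping.lookup x i = Poly_Mapping.lookup y i"
  proof (cases "i = k")
    case True
    then show ?thesis using face_le[OF xy(1), of i] face_le[OF xy(2), of i] by simp
  next
    case False
    then show ?thesis using arg_cong[OF xy(3), of "\<lambda>u. Poly_Mapping.lookup u i"] by (simp add: lookup_lift)
  qed
qed

lemma outer_above: "u \<in> outer k \<Longrightarrow> \<exists>i\<le>n. a i + 1 \<le> Poly_Mapping.lookup u i"
proof -
  assume u: "u \<in> outer k"
  then obtain i where i: "Poly_Mapping.lookup u i > Poly_Mapping.lookup (exps n a) i"
    by (auto simp: outer_def divisors_def not_le)
  then have "i \<in> Poly_Mapping.keys u" by (simp add: in_keys_iff)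
  then have "i \<le> n" using u keys by (auto simp: outer_def)
  with i show ?thesis by (intro exI[of _ i]) (simp add: lookup_exps)
qed

lemma above_outer: "u \<in> N \<Longrightarrow> u \<in> Mon n k \<Longrightarrow> a i + 1 \<le> Poly_Mapping.lookup u i \<Longrightarrow> i \<le> n \<Longrightarrow> u \<in> outer k"
  by (force simp: outer_def divisors_def lookup_exps)

lemma slice_outer:
  assumes "D > d"
  shows "N \<inter> Mon n D = outer D"
proof -
  have "u \<notin> Mon n D" if "u \<in> divisors (exps n a)" for u
  proof -
    have "(\<Sum>i\<le>n. Poly_Mapping.lookup u i) \<le> (\<Sum>i\<le>n. Poly_Mapping.lookup (exps n a) i)"
      using that by (intro sum_mono) (auto simp: divisors_def)
    also have "\<dots> = d" by (simp add: lookup_exps d_def)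
    finally show ?thesis using assms by (simp add: Mon_def)
  qed
  then show ?thesis by (auto simp: outer_def)
qed

text \<open>Otherwise the injective \<open>lift\<close> would place \<open>P\<close> monomials of
  degree \<open>S\<close> in \<open>N\<close>.\<close>

lemma exists_lift_notin:
  assumes bound: "\<And>k. card (N \<inter> Mon n k) < P" and k: "k \<le> n" "a k = a n"
  shows "\<exists>x\<in>face k. lift k S x \<notin> N"
proof (rule ccontr)
  assume "\<not> ?thesis"
  then have "lift k S ` face k \<subseteq> N \<inter> Mon n S"
    using lift_Mon[OF _ k(1)] face_degree(1)[OF _ k] by blast
  then have "card (face k) \<le> card (N \<inter> Mon n S)"
    by (intro card_inj_on_le[OF inj_lift] finite_slice)
  then show False using bound[of S] card_face[OF k] by simp
qed

text \<open>If \<open>S \<le> a n\<close>, homogenising to degree \<open>S\<close> raises the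
  exponent of \<open>x_n\<close> to at most \<open>a n\<close>; then all lifts of
  \<open>face n\<close> divide the monomial and lie in \<open>N\<close>.\<close>

lemma last_lt:
  assumes bound: "\<And>k. card (N \<inter> Mon n k) < P"
  shows "a n < S"
proof (rule ccontr)
  assume ge: "\<not> a n < S"
  obtain x where x: "x \<in> face n" "lift n S x \<notin> N" using exists_lift_notin[OF bound order_refl refl] by blast
  have "Poly_Mapping.lookup (lift n S x) i \<le> Poly_Mapping.lookup (exps n a) i" for i
    using face_le[OF x(1), of i] ge by (auto simp: lookup_lift lookup_exps)
  then show False using x(2) box_subset by (auto simp: divisors_def)
qed

text \<open>Lifts all of \<open>face n\<close> except its two extremes: \<open>1\<close> would need
  the exponent \<open>a n + 1\<close> at \<open>x_n\<close>, and the top element has degree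
  \<open>S\<close>, possibly \<open>a n + 2\<close>.\<close>

lemma card_box_slice:
  assumes "a n < S"
  shows "P - 2 \<le> card (divisors (exps n a) \<inter> Mon n (a n + 1))"
proof -
  define F where "F = face n - {0, exps n (a(n := 0))}"
  have "card {0, exps n (a(n := 0))} \<le> 2" by (rule card_insert_le_m1) auto
  then have "P - 2 \<le> card (face n) - card {0, exps n (a(n := 0))}"
    using card_face[of n] by simp
  also have "\<dots> \<le> card F" unfolding F_def by (rule diff_card_le_card_Diff) simp
  also have "\<dots> \<le> card (divisors (exps n a) \<inter> Mon n (a n + 1))"
  proof (rule card_inj_on_le)
    show "inj_on (lift n (a n + 1)) F" using inj_lift by (rule inj_on_subset) (auto simp: F_def)
    show "finite (divisors (exps n a) \<inter> Mon n (a n + 1))" using finite_Mon by blast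
    show "lift n (a n + 1) ` F \<subseteq> divisors (exps n a) \<inter> Mon n (a n + 1)"
    proof
      fix u assume "u \<in> lift n (a n + 1) ` F"
      then obtain x where x: "x \<in> face n" "x \<noteq> 0" "x \<noteq> exps n (a(n := 0))" "u = lift n (a n + 1) x"
        by (auto simp: F_def)
      let ?D = "\<Sum>i\<le>n. Poly_Mapping.lookup x i"
      have D1: "?D \<le> a n + 1"
      proof -
        have "?D \<le> S" using x(1) by (intro face_degree(1)[of x n]) auto
        moreover have "?D \<noteq> S" using face_degree(2)[OF x(1)] x(3) by auto
        ultimately show ?thesis using last_ge by (simp add: S_def)
      qed
      have D2: "?D \<ge> 1"
      proof (rule ccontr)
        assume "\<not> ?D \<ge> 1"
        then have "(\<Sum>i\<le>n. Poly_Mapping.lookup x i) = 0" by linarith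
        then have "Poly_Mapping.lookup x i = 0" for i
          using face_le[OF x(1), of i] by (cases "i \<le> n") auto
        then have "x = 0" by (intro poly_mapping_eqI) simp
        with x(2) show False ..
      qed
      have "Poly_Mapping.lookup u i \<le> Poly_Mapping.lookup (exps n a) i" for i
        using face_le[OF x(1), of i] D2 by (auto simp: x(4) lookup_lift lookup_exps)
      then show "u \<in> divisors (exps n a) \<inter> Mon n (a n + 1)"
        using lift_Mon[OF x(1) _ D1] x(4) by (simp add: divisors_def)
    qed
  qed
  finally show ?thesis .
qed

text \<open>
  If \<open>m\<close> is not the pure power \<open>x\<^sub>k ^ (a\<^sub>k + 1)\<close>, then \<open>m / x\<^sub>j\<close> still does not divide the monomial
  for some \<open>j\<close>, and \<open>m x\<^sub>j\<close> is the only multiple of \<open>m\<close> that can survive in the next degree.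
\<close>

lemma outer_stays_singleton:
  assumes E: "outer e \<subseteq> {m}" and m: "m \<in> Mon n e" "a k + 1 \<le> Poly_Mapping.lookup m k" "k \<le> n"
    and e: "e = a n + 1" "a k + 1 < e" and D: "e \<le> D"
  shows "\<exists>m. outer D \<subseteq> {m} \<and> m \<in> Mon n D \<and> a k + 1 \<le> Poly_Mapping.lookup m k"
  using D
proof (induction D rule: dec_induct)
  case base
  show ?case using E m(1,2) by (intro exI[of _ m]) simp
next
  case (step D)
  then obtain m where m: "outer D \<subseteq> {m}" "m \<in> Mon n D" "a k + 1 \<le> Poly_Mapping.lookup m k" by blast
  \<comment> \<open>The strict inequality \<open>a k + 1 < e\<close> leaves room to remove a
    variable while the exponent at \<open>k\<close> stays above \<open>a k\<close>.\<close>
  have "D = Suc (D - 1)" "a k + 1 \<le> D - 1" using step e by auto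
  then obtain j v where v: "m = v + Poly_Mapping.single j 1" "a k + 1 \<le> Poly_Mapping.lookup v k" "j \<le> n"
    "v \<in> Mon n (D - 1)"
    using Mon_split_above[of m n "D - 1" "a k + 1" k] m(2,3) by auto
  have "u = m + Poly_Mapping.single j 1" if u: "u \<in> outer (Suc D)" for u
  proof -
    obtain i where i: "i \<le> n" "a i + 1 \<le> Poly_Mapping.lookup u i" using outer_above[OF u] by blast
    have "a i + 1 \<le> D" using le_last[OF i(1)] e step by simp
    moreover have uN: "u \<in> Mon n (Suc D)" "u \<in> N" using u by (auto simp: outer_def)
    ultimately obtain q w where w: "u = w + Poly_Mapping.single q 1"
      "a i + 1 \<le> Poly_Mapping.lookup w i" "w \<in> Mon n D" "q \<le> n"
      using Mon_split_above[of u n D "a i + 1" i] i(2) by blast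
    then have "w \<in> N" using uN down by blast
    from above_outer[OF this w(3,2) i(1)] have "w = m" using m(1) by blast
    show ?thesis
    proof (cases "q = j")
      \<comment> \<open>Here \<open>v + Poly_Mapping.single q 1\<close> divides \<open>u\<close> and
        lies in \<open>outer D\<close>, so it would have to equal \<open>m\<close>, forcing
        \<open>q = j\<close>.\<close>
      case False
      have eq: "u = (v + Poly_Mapping.single q 1) + Poly_Mapping.single j 1"
        using w(1) \<open>w = m\<close> v(1) by (simp add: ac_simps)
      have "v + Poly_Mapping.single q 1 \<in> N" using uN(2) unfolding eq by (rule down)
      moreover have "v + Poly_Mapping.single q 1 \<in> Mon n D"
        using uN(1) unfolding eq Mon_add_single_iff by blast
      moreover have "a k + 1 \<le> Poly_Mapping.lookup (v + Poly_Mapping.single q 1) k"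
        using v(2) by (simp add: lookup_add)
      ultimately have "v + Poly_Mapping.single q 1 = m"
        using above_outer[of _ D k, OF _ _ _ \<open>k \<le> n\<close>] m(1) by blast
      then have "Poly_Mapping.single q (1::nat) = Poly_Mapping.single j 1" using v(1) by simp
      then have "Poly_Mapping.lookup (Poly_Mapping.single q (1::nat)) q = Poly_Mapping.lookup (Poly_Mapping.single j 1) q" by simp
      with False show ?thesis by (simp add: lookup_single when_def)
    qed (use w(1) \<open>w = m\<close> in simp)
  qed
  then have "outer (Suc D) \<subseteq> {m + Poly_Mapping.single j 1}" by blast
  moreover have "m + Poly_Mapping.single j 1 \<in> Mon n (Suc D)" using m(2) v(3) by (rule Mon_add_single)
  moreover have "a k + 1 \<le> Poly_Mapping.lookup (m + Poly_Mapping.single j 1) k" using m(3) by (simp add: lookup_add)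
  ultimately show ?case by blast
qed

text \<open>An exponent above \<open>a i\<close> with \<open>i \<noteq> k\<close> would survive in a
  divisor of degree \<open>e\<close>. That divisor lies in \<open>outer e\<close>, so it is
  \<open>m\<close>, which involves only \<open>x_k\<close>.\<close>

lemma pure_power_slice:
  assumes e: "e = a n + 1" and E: "outer e \<subseteq> {m}" and m: "\<And>i. i \<noteq> k \<Longrightarrow> Poly_Mapping.lookup m i = 0"
    and k: "k \<le> n" and D: "D \<ge> e"
  shows "N \<inter> Mon n D \<subseteq> lift k D ` face k"
proof
  fix u assume u: "u \<in> N \<inter> Mon n D"
  have le: "Poly_Mapping.lookup u i \<le> a i" if "i \<le> n" "i \<noteq> k" for i
  proof (rule ccontr)
    assume "\<not> ?thesis"
    moreover have "a i + 1 \<le> e" using le_last[OF that(1)] e by simp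
    ultimately obtain v where v: "v \<in> N \<inter> Mon n e" "a i + 1 \<le> Poly_Mapping.lookup v i"
      using divisor_above[of u D "a i + 1" i e] u D by auto
    then have "v = m" using above_outer[of v e i] that(1) E by blast
    with m[OF that(2)] v(2) show False by simp
  qed
  have out: "Poly_Mapping.lookup u i = 0" if "\<not> i \<le> n" for i
  proof -
    have "i \<notin> Poly_Mapping.keys u" using keys[of u] u that by auto
    then show ?thesis by (simp add: in_keys_iff)
  qed
  define x where "x = u - Poly_Mapping.single k (Poly_Mapping.lookup u k)"
  have lx: "Poly_Mapping.lookup x i = (if i = k then 0 else Poly_Mapping.lookup u i)" for i
    by (simp add: x_def lookup_minus lookup_single when_def)
  have x: "x \<in> face k"
    using le out by (auto simp: face_def divisors_def lookup_exps lx)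
  have "(\<Sum>i\<le>n. Poly_Mapping.lookup u i) = Poly_Mapping.lookup u k + (\<Sum>i\<in>{..n} - {k}. Poly_Mapping.lookup u i)"
    using k by (simp add: sum.remove[of "{..n}" k])
  moreover have "(\<Sum>i\<le>n. Poly_Mapping.lookup x i) = (\<Sum>i\<in>{..n} - {k}. Poly_Mapping.lookup u i)"
    using k by (subst sum.remove[of _ k]) (auto simp: lx intro!: sum.cong)
  moreover have "(\<Sum>i\<le>n. Poly_Mapping.lookup u i) = D" using u by (simp add: Mon_def)
  ultimately have "Poly_Mapping.lookup u k = D - (\<Sum>i\<le>n. Poly_Mapping.lookup x i)" by linarith
  then have "u = lift k D x"
    by (intro poly_mapping_eqI) (auto simp: lookup_lift lx)
  with x show "u \<in> lift k D ` face k" by blast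
qed

text \<open>For \<open>n = 1\<close> the sum \<open>S\<close> is \<open>a 0 \<le> a n\<close>. So
  \<open>P\<close> has at least two factors, each at least \<open>2\<close>.\<close>

lemma P_ge_4:
  assumes "a n < S"
  shows "P \<ge> 4"
proof -
  have "n \<noteq> 1" using assms le_last[of 0] by (auto simp: S_def)
  then have "(2::nat) ^ 2 \<le> 2 ^ n" using n by (intro power_increasing) auto
  also have "\<dots> = (\<Prod>i<n. 2)" by simp
  also have "\<dots> \<le> P" unfolding P_def
  proof (rule prod_mono)
    fix i assume "i \<in> {..<n}"
    then show "0 \<le> (2::nat) \<and> 2 \<le> a i + 1" using pos[of i] by simp
  qed
  finally show ?thesis by simp
qed

lemma exists_large_slice: "\<exists>k. P \<le> card (N \<inter> Mon n k)"
proof (rule ccontr)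
  assume "\<not> ?thesis"
  then have bound: "card (N \<inter> Mon n k) < P" for k by (simp add: not_le)
  have lt: "a n < S" by (rule last_lt[OF bound])
  have P4: "P \<ge> 4" by (rule P_ge_4[OF lt])
  \<comment> \<open>As \<open>a i + 1 \<le> e\<close> for all \<open>i \<le> n\<close>, every outer
    monomial of degree at least \<open>e\<close> has an outer divisor of degree
    \<open>e\<close>.\<close>
  define e where "e = a n + 1"
  have ed: "e \<le> d" using d_eq lt by (simp add: e_def)
  have finE: "finite (outer e)" using finite_slice by (simp add: outer_def)
  have split: "card (N \<inter> Mon n e) = card (divisors (exps n a) \<inter> Mon n e) + card (outer e)"
  proof -
    have "N \<inter> Mon n e = (divisors (exps n a) \<inter> Mon n e) \<union> outer e" using box_subset by (auto simp: outer_def)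
    moreover have "(divisors (exps n a) \<inter> Mon n e) \<inter> outer e = {}" by (auto simp: outer_def)
    ultimately show ?thesis using finE finite_Mon by (simp add: card_Un_disjoint)
  qed
  have box_e: "P - 2 \<le> card (divisors (exps n a) \<inter> Mon n e)" using card_box_slice[OF lt] by (simp add: e_def)
  then have "card (outer e) \<le> 1" using split bound[of e] by simp
  have mono_e: "card (N \<inter> Mon n e) \<le> card (outer (Suc d))"
    using mono_le[of e "Suc d"] ed slice_outer[of "Suc d"] by (simp add: e_def)
  have "outer e \<noteq> {}"
  proof
    assume E: "outer e = {}"
    \<comment> \<open>With \<open>P \<ge> 4\<close>, monotonicity asks for at least
      \<open>P - 2 > 0\<close> monomials in degree \<open>d + 1\<close>, where all are
      outer.\<close>
    have "outer (Suc d) \<noteq> {}" using mono_e box_e split P4 by auto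
    then obtain u where u: "u \<in> outer (Suc d)" by blast
    then obtain i where i: "i \<le> n" "a i + 1 \<le> Poly_Mapping.lookup u i" using outer_above by blast
    then have "a i + 1 \<le> e" using le_last by (simp add: e_def)
    moreover have "u \<in> N" "u \<in> Mon n (Suc d)" using u by (auto simp: outer_def)
    ultimately obtain v where "v \<in> N \<inter> Mon n e" "a i + 1 \<le> Poly_Mapping.lookup v i"
      using divisor_above[of u "Suc d" "a i + 1" i e] i ed by auto
    then show False using above_outer[of v e i] i E by auto
  qed
  with \<open>card (outer e) \<le> 1\<close> obtain m where m: "outer e = {m}"
    using finE card_1_singletonE[of "outer e"] card_0_eq[of "outer e"]
    by (cases "card (outer e)") auto
  then have slice_d: "P - 1 \<le> card (outer (Suc d))" using mono_e box_e split by simp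
  have mM: "m \<in> Mon n e" using m by (auto simp: outer_def)
  obtain k where k: "k \<le> n" "a k + 1 \<le> Poly_Mapping.lookup m k" using outer_above[of m e] m by blast
  show False
  proof (cases "a k + 1 < e")
    case True
    obtain m' where "outer (Suc d) \<subseteq> {m'}"
      using outer_stays_singleton[OF _ mM k(2,1) e_def True, of "Suc d"] m ed by auto
    then have "card (outer (Suc d)) \<le> 1" using card_mono[of "{m'}"] by simp
    then show False using slice_d P4 by simp
  next
    case False
    then have ak: "a k = a n" using le_last[OF k(1)] by (simp add: e_def)
    \<comment> \<open>Now \<open>m\<close> has degree \<open>a k + 1\<close>, all of it used up by
      \<open>x_k\<close>.\<close>
    have m0: "Poly_Mapping.lookup m i = 0" if "i \<noteq> k" for i
    proof (cases "i \<le> n")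
      case True
      have "Poly_Mapping.lookup m k + Poly_Mapping.lookup m i = (\<Sum>i\<in>{k,i}. Poly_Mapping.lookup m i)" using that by simp
      also have "\<dots> \<le> (\<Sum>i\<le>n. Poly_Mapping.lookup m i)" using True k(1) by (intro sum_mono2) auto
      also have "\<dots> = e" using mM by (simp add: Mon_def)
      finally show ?thesis using k(2) ak by (simp add: e_def)
    next
      case False
      then have "i \<notin> Poly_Mapping.keys m" using mM by (auto simp: Mon_def)
      then show ?thesis by (simp add: in_keys_iff)
    qed
    let ?D = "Suc d"
    have sub: "N \<inter> Mon n ?D \<subseteq> lift k ?D ` face k"
      using m ed by (intro pure_power_slice[OF e_def _ m0 k(1)]) auto
    obtain x where x: "x \<in> face k" "lift k S x \<notin> N" using exists_lift_notin[OF bound k(1) ak] by blast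
    have degx: "(\<Sum>i\<le>n. Poly_Mapping.lookup x i) \<le> S" by (rule face_degree(1)[OF x(1) k(1) ak])
    \<comment> \<open>In degree \<open>S\<close> the lift is \<open>x\<close> itself, a divisor of
      the monomial and hence in \<open>N\<close>.\<close>
    have "(\<Sum>i\<le>n. Poly_Mapping.lookup x i) \<noteq> S"
    proof
      assume S: "(\<Sum>i\<le>n. Poly_Mapping.lookup x i) = S"
      then have "lift k S x = x" by (simp add: lift_def)
      moreover have "Poly_Mapping.lookup x i \<le> Poly_Mapping.lookup (exps n a) i" for i
        using face_le[OF x(1), of i] by (auto simp: lookup_exps split: if_splits)
      then have "x \<in> divisors (exps n a)" by (simp add: divisors_def)
      ultimately show False using x(2) box_subset by auto
    qed
    with degx have degx': "(\<Sum>i\<le>n. Poly_Mapping.lookup x i) < S" by simp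
    have "\<exists>j\<le>n. j \<noteq> k \<and> Poly_Mapping.lookup x j < a j"
    proof (rule ccontr)
      assume no: "\<not> ?thesis"
      have "d = a k + (\<Sum>i\<in>{..n} - {k}. a i)"
        unfolding d_def using k(1) by (simp add: sum.remove[of "{..n}" k])
      also have "\<dots> \<le> a k + (\<Sum>i\<in>{..n} - {k}. Poly_Mapping.lookup x i)"
        using no by (intro add_left_mono sum_mono) (auto simp: not_less)
      also have "\<dots> \<le> a k + (\<Sum>i\<le>n. Poly_Mapping.lookup x i)"
        by (intro add_left_mono sum_mono2) auto
      finally show False using degx' d_eq ak by simp
    qed
    then obtain j where j: "j \<le> n" "j \<noteq> k" "Poly_Mapping.lookup x j < a j" by blast
    define x' where "x' = x + Poly_Mapping.single j 1"
    have lx': "Poly_Mapping.lookup x' i = Poly_Mapping.lookup x i + (if i = j then 1 else 0)" for i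
      by (simp add: x'_def lookup_add lookup_single when_def)
    have "Poly_Mapping.lookup x' i \<le> Poly_Mapping.lookup (exps n (a(k := 0))) i" for i
      using face_le[OF x(1), of i] j by (auto simp: lookup_exps lx' split: if_splits)
    then have x'F: "x' \<in> face k" by (simp add: face_def divisors_def)
    have degx'': "(\<Sum>i\<le>n. Poly_Mapping.lookup x' i) = (\<Sum>i\<le>n. Poly_Mapping.lookup x i) + 1"
      using j(1) by (simp add: lx' sum.distrib)
    \<comment> \<open>Both lifts are multiples of \<open>lift k S x\<close>. For \<open>x'\<close>
      the exponent of \<open>x_k\<close> is \<open>d + 1\<close> minus the degree of
      \<open>x'\<close>, that is \<open>d\<close> minus the degree of \<open>x\<close>, and
      \<open>d \<ge> S\<close>.\<close>
    have nin: "lift k ?D x \<notin> N" "lift k ?D x' \<notin> N"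
    proof -
      have "Poly_Mapping.lookup (lift k S x) i \<le> Poly_Mapping.lookup (lift k ?D x) i"
           "Poly_Mapping.lookup (lift k S x) i \<le> Poly_Mapping.lookup (lift k ?D x') i" for i
        unfolding lookup_lift degx'' using degx d_eq lx'[of i] by (auto split: if_splits)
      then show "lift k ?D x \<notin> N" "lift k ?D x' \<notin> N" using x(2) downward by blast+
    qed
    have "x \<noteq> x'" using lx'[of j] by auto
    have "N \<inter> Mon n ?D \<subseteq> lift k ?D ` (face k - {x, x'})" using sub nin by blast
    then have "card (N \<inter> Mon n ?D) \<le> card (face k - {x, x'})"
      by (intro surj_card_le finite_Diff finite_face)
    also have "\<dots> = P - 2"
      using card_face[OF k(1) ak] x(1) x'F \<open>x \<noteq> x'\<close> by (simp add: card_Diff_subset)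
    finally show False using slice_d slice_outer[of ?D] P4 by simp
  qed
qed

end

subsection \<open>Border rank of monomials\<close>

lemma lookup_single_mult_add:
  fixes g :: "'a::cancel_comm_monoid_add \<Rightarrow>\<^sub>0 'b::semiring_0"
  shows "Poly_Mapping.lookup (Poly_Mapping.single v c * g) (w + v) = c * Poly_Mapping.lookup g w"
proof -
  have "(w + v = v + q) = (q = w)" for q by (metis add.commute add_left_cancel)
  then show ?thesis by (simp add: lookup_mult lookup_single when_mult)
qed

lemma lookup_single_mult_eq_0:
  fixes g :: "'a::comm_monoid_add \<Rightarrow>\<^sub>0 'b::semiring_0"
  assumes "\<And>w. u \<noteq> w + v"
  shows "Poly_Mapping.lookup (Poly_Mapping.single v c * g) u = 0"
proof -
  have "u \<noteq> v + q" for q using assms[of q] by (simp add: add.commute)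
  then show ?thesis by (simp add: lookup_mult lookup_single when_mult)
qed

section \<open>Coefficients of powers of linear forms\<close>

text \<open>For \<open>u\<close> of degree \<open>d\<close>, \<open>fact d / fact_exps n u\<close>
  is the multinomial coefficient.\<close>

definition fact_exps :: "nat \<Rightarrow> (nat \<Rightarrow>\<^sub>0 nat) \<Rightarrow> complex" where
  "fact_exps n u = (\<Prod>i\<le>n. fact (Poly_Mapping.lookup u i))"

lemma fact_exps_nonzero: "fact_exps n u \<noteq> 0"
  by (simp add: fact_exps_def)

lemma fact_exps_add_single:
  assumes "i \<le> n"
  shows "fact_exps n (u + Poly_Mapping.single i 1) = of_nat (Poly_Mapping.lookup u i + 1) * fact_exps n u"
proof -
  have "fact_exps n (u + Poly_Mapping.single i 1) =
      fact (Poly_Mapping.lookup u i + 1) * (\<Prod>j\<in>{..n} - {i}. fact (Poly_Mapping.lookup u j))"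
    unfolding fact_exps_def using assms
    by (subst prod.remove[of _ i])
      (auto simp: lookup_add lookup_single when_def intro!: prod.cong)
  also have "\<dots> = of_nat (Poly_Mapping.lookup u i + 1) * fact_exps n u"
    unfolding fact_exps_def using assms
    by (subst (2) prod.remove[of _ i]) (simp_all add: mult_ac)
  finally show ?thesis .
qed

text \<open>The multinomial theorem. In the induction the summand with \<open>x_i\<close>
  contributes \<open>fact d / fact_exps n u * mono_eval n c u\<close> times the exponent of
  \<open>u\<close> at \<open>i\<close>, and these exponents add up to \<open>d + 1\<close>.\<close>

lemma lookup_linear_form_power:
  "Poly_Mapping.lookup ((\<Sum>i\<le>n. Const (c i) * X i) ^ d) u =
     (if u \<in> Mon n d then fact d / fact_exps n u * mono_eval n c u else 0)"
proof (induction d arbitrary: u)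
  case 0
  have "u \<in> Mon n 0 \<longleftrightarrow> u = 0"
  proof
    assume "u \<in> Mon n 0"
    then have "Poly_Mapping.lookup u i = 0" for i by (cases "i \<le> n") (auto simp: Mon_def in_keys_iff)
    then show "u = 0" by (intro poly_mapping_eqI) simp
  qed (simp add: Mon_def)
  then show ?case by (auto simp: lookup_one fact_exps_def mono_eval_def when_def)
next
  case (Suc d)
  let ?L = "\<Sum>i\<le>n. Const (c i) * X i"
  have cX: "Const (c i) * X i = Poly_Mapping.single (Poly_Mapping.single i 1) (c i)" for i
    by (simp add: Const_def X_def mult_single)
  have expand: "Poly_Mapping.lookup (?L ^ Suc d) u =
      (\<Sum>i\<le>n. Poly_Mapping.lookup (Poly_Mapping.single (Poly_Mapping.single i 1) (c i) * ?L ^ d) u)"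
    by (simp add: cX sum_distrib_right lookup_sum)
  show ?case
  proof (cases "u \<in> Mon n (Suc d)")
    case True
    have "Poly_Mapping.lookup (Poly_Mapping.single (Poly_Mapping.single i 1) (c i) * ?L ^ d) u
        = fact d / fact_exps n u * mono_eval n c u * of_nat (Poly_Mapping.lookup u i)" if i: "i \<le> n" for i
    proof (cases "Poly_Mapping.lookup u i \<ge> 1")
      case u1: True
      define w where "w = u - Poly_Mapping.single i 1"
      have u: "u = w + Poly_Mapping.single i 1"
        unfolding w_def using u1 by (rule lookup_eq_minus_add_single)
      have "w \<in> Mon n d" using True unfolding u Mon_add_single_iff by blast
      then have w: "Poly_Mapping.lookup (?L ^ d) w = fact d / fact_exps n w * mono_eval n c w"
        using Suc.IH[of w] by simp
      have "Poly_Mapping.lookup u i = Poly_Mapping.lookup w i + 1" by (simp add: u lookup_add)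
      moreover have "fact_exps n u = of_nat (Poly_Mapping.lookup w i + 1) * fact_exps n w"
        unfolding u by (rule fact_exps_add_single[OF i])
      moreover have "mono_eval n c u = c i * mono_eval n c w"
        unfolding u by (rule mono_eval_add_single[OF i])
      ultimately have "fact d / fact_exps n u * mono_eval n c u * of_nat (Poly_Mapping.lookup u i) =
          c i * (fact d / fact_exps n w * mono_eval n c w)"
        using fact_exps_nonzero[of n w] by (simp add: field_simps del: of_nat_Suc)
      moreover have "Poly_Mapping.lookup (Poly_Mapping.single (Poly_Mapping.single i 1) (c i) * ?L ^ d) u =
          c i * Poly_Mapping.lookup (?L ^ d) w"
        unfolding u by (rule lookup_single_mult_add)
      ultimately show ?thesis by (simp only: w)
    next
      case False
      have "u \<noteq> w + Poly_Mapping.single i 1" for w using False by (auto simp: lookup_add)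
      with False show ?thesis by (simp add: lookup_single_mult_eq_0)
    qed
    then have "Poly_Mapping.lookup (?L ^ Suc d) u = fact d / fact_exps n u * mono_eval n c u * of_nat (\<Sum>i\<le>n. Poly_Mapping.lookup u i)"
      unfolding expand by (simp add: sum_distrib_left)
    also have "(\<Sum>i\<le>n. Poly_Mapping.lookup u i) = Suc d" using True by (simp add: Mon_def)
    finally show ?thesis using True by simp
  next
    case False
    have "Poly_Mapping.lookup (Poly_Mapping.single (Poly_Mapping.single i 1) (c i) * ?L ^ d) u = 0" if "i \<le> n" for i
    proof (cases "\<exists>w. u = w + Poly_Mapping.single i 1")
      case True
      then obtain w where w: "u = w + Poly_Mapping.single i 1" by blast
      then have "w \<notin> Mon n d" using False Mon_add_single that by blast
      then show ?thesis unfolding w lookup_single_mult_add using Suc.IH[of w] by simp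
    next
      case F: False
      then show ?thesis by (intro lookup_single_mult_eq_0) blast
    qed
    then show ?thesis using False unfolding expand by simp
  qed
qed

lemma prod_X_power: "(\<Prod>i\<le>n. X i ^ a i) = Poly_Mapping.single (exps n a) 1"
proof -
  have "X i ^ k = Poly_Mapping.single (Poly_Mapping.single i k) 1" for i k
    by (induction k) (simp_all add: X_def mult_single single_add[symmetric])
  moreover have "(\<Prod>i\<in>I. Poly_Mapping.single (f i) (1::complex)) = Poly_Mapping.single (\<Sum>i\<in>I. f i) 1"
    if "finite I" for I and f :: "nat \<Rightarrow> nat \<Rightarrow>\<^sub>0 nat"
    using that by (induction I rule: finite_induct) (simp_all add: mult_single)
  ultimately show ?thesis by (simp add: exps_def)
qed

lemma exps_Mon: "exps n a \<in> Mon n (\<Sum>i\<le>n. a i)"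
  by (auto simp: Mon_def lookup_exps in_keys_iff split: if_splits)

lemma monomial_in_forms: "(\<Prod>i\<le>n. X i ^ a i) \<in> forms n (\<Sum>i\<le>n. a i)"
proof -
  have keys: "Poly_Mapping.keys (exps n a) \<subseteq> {..n}"
    by (auto simp: lookup_exps in_keys_iff split: if_splits)
  then have "(\<Sum>i\<in>Poly_Mapping.keys (exps n a). Poly_Mapping.lookup (exps n a) i) = (\<Sum>i\<le>n. Poly_Mapping.lookup (exps n a) i)"
    by (intro sum.mono_neutral_left) (auto simp: in_keys_iff)
  also have "\<dots> = (\<Sum>i\<le>n. a i)" by (simp add: lookup_exps)
  finally show ?thesis using keys by (simp add: forms_def prod_X_power)
qed

section \<open>Lower bound: from limits of power sums to standard monomials\<close>

lemma border_rank_monomial_ge: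
  assumes n: "n \<ge> 1" and pos: "\<And>i. i \<le> n \<Longrightarrow> 1 \<le> a i"
    and le_last: "\<And>i. i \<le> n \<Longrightarrow> a i \<le> a n"
    and last_ge: "(\<Sum>i<n. a i) \<le> a n + 2"
    and sec: "(\<Prod>i\<le>n. X i ^ a i) \<in> secant_cone n (\<Sum>i\<le>n. a i) r"
  shows "(\<Prod>i<n. a i + 1) \<le> r"
proof -
  let ?d = "\<Sum>i\<le>n. a i" and ?F = "\<Prod>i\<le>n. X i ^ a i"
  obtain G where G: "\<And>k. \<exists>v. (\<forall>j<r. v j \<in> veronese_cone n ?d) \<and> G k = (\<Sum>j<r. v j)"
    and lim: "\<And>m. (\<lambda>k. Poly_Mapping.lookup (G k) m) \<longlonglongrightarrow> Poly_Mapping.lookup ?F m"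
    using sec by (auto simp: secant_cone_def)
  have "\<exists>c. G k = (\<Sum>j<r. (\<Sum>i\<le>n. Const (c j i) * X i) ^ ?d)" for k
  proof -
    obtain v where v: "\<And>j. j < r \<Longrightarrow> v j \<in> veronese_cone n ?d" "G k = (\<Sum>j<r. v j)" using G by blast
    have "\<exists>c. v j = (\<Sum>i\<le>n. Const (c i) * X i) ^ ?d" if "j < r" for j
      using v(1)[OF that] by (auto simp: veronese_cone_def linear_forms_def)
    then obtain c where "\<And>j. j < r \<Longrightarrow> v j = (\<Sum>i\<le>n. Const (c j i) * X i) ^ ?d" by metis
    then show ?thesis using v(2) by auto
  qed
  then have "\<forall>k. \<exists>c. G k = (\<Sum>j<r. (\<Sum>i\<le>n. Const (c j i) * X i) ^ ?d)" by blast
  from choice[OF this] obtain p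
    where p: "\<And>k. G k = (\<Sum>j<r. (\<Sum>i\<le>n. Const (p k j i) * X i) ^ ?d)" by blast
  \<comment> \<open>Refining \<open>sequentially\<close> keeps the given coefficientwise limits
    valid along \<open>U\<close>.\<close>
  obtain U :: "nat filter" where ultra: "is_ultrafilter U" "U \<le> sequentially"
    using ultrafilter_ex[of sequentially] by auto
  interpret point_family n r p U by unfold_locales (rule ultra(1))
  \<comment> \<open>Dividing by the multinomial coefficient turns the coefficients of a power of a
    linear form into evaluations of monomials at its coefficient vector.\<close>
  define \<Phi> where "\<Phi> u = fact_exps n u / fact ?d * Poly_Mapping.lookup ?F u" for u
  have "((\<lambda>k. \<Sum>j<r. mono_eval n (p k j) u) \<longlongrightarrow> \<Phi> u) U" if u: "u \<in> Mon n ?d" for u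
  proof (rule tendsto_mono[OF ultra(2)])
    have "(\<lambda>k. fact_exps n u / fact ?d * Poly_Mapping.lookup (G k) u) \<longlonglongrightarrow> \<Phi> u"
      unfolding \<Phi>_def by (intro tendsto_mult tendsto_const lim)
    moreover have "Poly_Mapping.lookup (G k) u =
        fact ?d / fact_exps n u * (\<Sum>j<r. mono_eval n (p k j) u)" for k
      using u by (simp add: p lookup_sum lookup_linear_form_power sum_distrib_left)
    then have "fact_exps n u / fact ?d * Poly_Mapping.lookup (G k) u =
        (\<Sum>j<r. mono_eval n (p k j) u)" for k
      using fact_exps_nonzero[of n u] by simp
    ultimately show "(\<lambda>k. \<Sum>j<r. mono_eval n (p k j) u) \<longlonglongrightarrow> \<Phi> u" by simp
  qed
  then have top: "exps n a \<in> std ?d"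
    by (intro apolar_in_std[where \<Phi> = \<Phi>] exps_Mon)
      (auto simp: \<Phi>_def prod_X_power lookup_single when_def fact_exps_nonzero)
  define N where "N = (\<Union>k. std k)"
  have slice: "N \<inter> Mon n k = std k" for k
    using std_subset by (fastforce simp: N_def Mon_def)
  interpret large_box n N a
  proof unfold_locales
    show "Poly_Mapping.keys u \<subseteq> {..n}" if "u \<in> N" for u
      using that std_subset by (fastforce simp: N_def Mon_def)
    show "u \<in> N" if ui: "u + Poly_Mapping.single i 1 \<in> N" for u i
    proof -
      obtain k where k: "u + Poly_Mapping.single i 1 \<in> std k" using ui by (auto simp: N_def)
      show ?thesis
      proof (cases k)
        \<comment> \<open>Contradictory, since a multiple of a variable does not have degree
          \<open>0\<close>.\<close>
        case 0
        then have M: "u + Poly_Mapping.single i 1 \<in> Mon n 0" using k std_subset by blast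
        have i: "i \<in> Poly_Mapping.keys (u + Poly_Mapping.single i 1)"
          by (simp add: in_keys_iff lookup_add)
        then have "i \<le> n" using M by (auto simp: Mon_def)
        then have "Poly_Mapping.lookup (u + Poly_Mapping.single i 1) i = 0"
          using M by (simp add: Mon_def)
        then show ?thesis using i by (simp add: in_keys_iff)
      next
        case (Suc k')
        then show ?thesis using k std_downward by (auto simp: N_def)
      qed
    qed
    show "exps n a \<in> N" using top by (auto simp: N_def)
    show "card (N \<inter> Mon n k) \<le> card (N \<inter> Mon n (Suc k))" if "k \<ge> 1" for k
      unfolding slice using that by (rule card_std_mono)
  qed (use assms in auto)
  from exists_large_slice obtain k where "P \<le> card (std k)" unfolding slice by blast
  also have "\<dots> \<le> r" by (rule card_std_le)
  finally show ?thesis by (simp add: P_def)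
qed

section \<open>Upper bound: sums over roots of unity\<close>

lemma complex_root_exists:
  assumes "m > 0"
  shows "\<exists>w::complex. w ^ m = z"
proof (cases "z = 0")
  case True
  then show ?thesis using assms by (intro exI[of _ 0]) simp
next
  case False
  then show ?thesis using assms
    by (intro exI[of _ "exp (Ln z / of_nat m)"]) (simp add: exp_of_nat_mult[symmetric])
qed

text \<open>If \<open>m\<close> does not divide \<open>b\<close>, some root \<open>w\<close> has
  \<open>w ^ b \<noteq> 1\<close>, because \<open>z ^ (b mod m) = 1\<close> has fewer than
  \<open>m\<close> solutions. Multiplication by \<open>w\<close> permutes the roots, so the sum
  equals \<open>w ^ b\<close> times itself.\<close>

lemma sum_roots_unity_power:
  assumes "m \<ge> 1"
  shows "(\<Sum>z | z ^ m = 1. z ^ b) = (if m dvd b then of_nat m else (0::complex))"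
proof (cases "m dvd b")
  case True
  then have "z ^ b = 1" if "z ^ m = 1" for z :: complex
    using that by (auto simp: power_mult)
  then show ?thesis using True card_roots_unity_eq[of m] assms by simp
next
  case False
  let ?Z = "{z::complex. z ^ m = 1}"
  have "\<exists>w\<in>?Z. w ^ b \<noteq> 1"
  proof (rule ccontr)
    assume no: "\<not> ?thesis"
    have "?Z \<subseteq> {z. z ^ (b mod m) = 1}"
    proof
      fix z assume z: "z \<in> ?Z"
      then have "z ^ b = 1" using no by auto
      moreover have "z ^ b = (z ^ m) ^ (b div m) * z ^ (b mod m)"
        by (metis mult_div_mod_eq power_add power_mult)
      ultimately show "z \<in> {z. z ^ (b mod m) = 1}" using z by simp
    qed
    moreover have b: "b mod m > 0" using False by (simp add: dvd_eq_mod_eq_0)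
    ultimately have "card ?Z \<le> card {z::complex. z ^ (b mod m) = 1}"
      by (intro card_mono finite_roots_unity) auto
    then have "m \<le> b mod m" using card_roots_unity_eq[of m] card_roots_unity_eq[OF b] assms by simp
    moreover have "b mod m < m" using assms by simp
    ultimately show False by linarith
  qed
  then obtain w :: complex where w: "w ^ m = 1" "w ^ b \<noteq> 1" by auto
  then have "w \<noteq> 0" using assms by (auto simp: power_0_left)
  have "bij_betw (\<lambda>z. w * z) ?Z ?Z"
    by (rule bij_betw_byWitness[where f' = "\<lambda>z. z / w"])
      (use w(1) \<open>w \<noteq> 0\<close> in \<open>auto simp: power_mult_distrib power_divide\<close>)
  then have "(\<Sum>z\<in>?Z. z ^ b) = (\<Sum>z\<in>?Z. (w * z) ^ b)"
    by (rule sum.reindex_bij_betw[symmetric])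
  also have "\<dots> = w ^ b * (\<Sum>z\<in>?Z. z ^ b)" by (simp add: power_mult_distrib sum_distrib_left)
  finally show ?thesis using w(2) False by simp
qed

text \<open>
  Summing \<open>(x\<^sub>n + s (z\<^sub>0 x\<^sub>0 + \<dots> + z\<^sub>m x\<^sub>m))\<^sup>d\<close>, \<open>m = n - 1\<close>, with weights \<open>z\<^sub>0 \<cdots> z\<^sub>m\<close> over the roots of
  unity \<open>z\<^sub>i\<close> of order \<open>a\<^sub>i + 1\<close> keeps only the monomials with exponents congruent to \<open>a\<^sub>i\<close> modulo
  \<open>a\<^sub>i + 1\<close> for \<open>i < n\<close>; among these the given one has the lowest order in \<open>s\<close>.
\<close>

lemma monomial_in_secant_cone:
  assumes d: "(\<Sum>i\<le>n. a i) \<ge> 1"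
  shows "(\<Prod>i\<le>n. X i ^ a i) \<in> secant_cone n (\<Sum>i\<le>n. a i) (\<Prod>i<n. a i + 1)"
proof -
  let ?d = "\<Sum>i\<le>n. a i" and ?F = "\<Prod>i\<le>n. X i ^ a i"
  define S where "S = (\<Sum>i<n. a i)"
  define P where "P = (\<Prod>i<n. a i + 1)"
  define Z where "Z i = {z::complex. z ^ (a i + 1) = 1}" for i
  define ZZ where "ZZ = PiE {..<n} Z"
  \<comment> \<open>Cancels the multinomial coefficient of the target and the factor
    \<open>P\<close> from the root sums.\<close>
  define C where "C = fact_exps n (exps n a) / (fact ?d * of_nat P)"
  define s :: "nat \<Rightarrow> complex" where "s k = 1 / of_nat (Suc k)" for k
  have s0: "s k \<noteq> 0" for k by (simp add: s_def del: of_nat_Suc)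
  have s_lim: "s \<longlonglongrightarrow> 0" unfolding s_def by (rule lim_1_over_n[THEN LIMSEQ_Suc])
  have finZ: "finite (Z i)" for i unfolding Z_def by (rule finite_roots_unity) simp
  have "card (Z i) = a i + 1" for i unfolding Z_def by (rule card_roots_unity_eq) simp
  then have "card ZZ = P" by (simp add: ZZ_def P_def card_PiE)
  then obtain h where h: "bij_betw h {..<P} ZZ"
    using ex_bij_betw_nat_finite[of ZZ] finZ by (auto simp: ZZ_def finite_PiE atLeast0LessThan)
  \<comment> \<open>The scalar weight of each summand, including the division by
    \<open>s k ^ S\<close>, is absorbed into the linear form through a root of order
    \<open>?d\<close>.\<close>
  have "\<exists>w. w ^ ?d = C * (\<Prod>i<n. z i) / s k ^ S" for k and z :: "nat \<Rightarrow> complex"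
    by (rule complex_root_exists) (use d in simp)
  then have "\<exists>w. \<forall>k z. w k z ^ ?d = C * (\<Prod>i<n. z i) / s k ^ S"
    by (intro choice allI)
  then obtain w where w: "\<And>k z. w k z ^ ?d = C * (\<Prod>i<n. z i) / s k ^ S" by blast
  define c where "c k z i = w k z * (if i < n then s k * z i else 1)" for k z i
  define G where "G k = (\<Sum>j<P. (\<Sum>i\<le>n. Const (c k (h j) i) * X i) ^ ?d)" for k
  define T where "T u = (\<Sum>i<n. Poly_Mapping.lookup u i)" for u :: "nat \<Rightarrow>\<^sub>0 nat"
  \<comment> \<open>The sum over all tuples of roots factors over \<open>i\<close>; the
    \<open>+ 1\<close> in the exponent comes from the weight \<open>z i\<close>.\<close>
  define R where "R u = (\<Prod>i<n. \<Sum>z\<in>Z i. z ^ (Poly_Mapping.lookup u i + 1))" for u :: "nat \<Rightarrow>\<^sub>0 nat"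
  have eval: "mono_eval n (c k z) u = C * (s k ^ T u / s k ^ S) * (\<Prod>i<n. z i ^ (Poly_Mapping.lookup u i + 1))"
    if u: "u \<in> Mon n ?d" for k z u
  proof -
    have "mono_eval n (c k z) u = (\<Prod>i\<le>n. w k z ^ Poly_Mapping.lookup u i) * (\<Prod>i\<le>n. (if i < n then s k * z i else 1) ^ Poly_Mapping.lookup u i)"
      by (simp add: mono_eval_def c_def power_mult_distrib prod.distrib)
    also have "(\<Prod>i\<le>n. w k z ^ Poly_Mapping.lookup u i) = w k z ^ ?d"
      using u by (simp add: Mon_def power_sum[symmetric])
    also have "(\<Prod>i\<le>n. (if i < n then s k * z i else 1) ^ Poly_Mapping.lookup u i) = (\<Prod>i<n. (s k * z i) ^ Poly_Mapping.lookup u i)"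
      unfolding lessThan_Suc_atMost[symmetric] by simp
    also have "\<dots> = s k ^ T u * (\<Prod>i<n. z i ^ Poly_Mapping.lookup u i)"
      by (simp add: T_def power_mult_distrib prod.distrib power_sum)
    finally show ?thesis by (simp add: w prod.distrib mult_ac)
  qed
  have G: "Poly_Mapping.lookup (G k) u = fact ?d / fact_exps n u * C * (s k ^ T u / s k ^ S) * R u"
    if u: "u \<in> Mon n ?d" for k u
  proof -
    have "Poly_Mapping.lookup (G k) u = fact ?d / fact_exps n u * (\<Sum>j<P. mono_eval n (c k (h j)) u)"
      using u by (simp add: G_def lookup_sum lookup_linear_form_power sum_distrib_left)
    also have "(\<Sum>j<P. mono_eval n (c k (h j)) u) = (\<Sum>z\<in>ZZ. mono_eval n (c k z) u)"
      by (rule sum.reindex_bij_betw[OF h])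
    also have "\<dots> = C * (s k ^ T u / s k ^ S) * (\<Sum>z\<in>ZZ. \<Prod>i<n. z i ^ (Poly_Mapping.lookup u i + 1))"
      by (simp only: eval[OF u] sum_distrib_left)
    also have "(\<Sum>z\<in>ZZ. \<Prod>i<n. z i ^ (Poly_Mapping.lookup u i + 1)) = R u"
      unfolding ZZ_def R_def using finZ by (intro prod_sum_PiE[symmetric]) auto
    finally show ?thesis by (simp only: mult_ac)
  qed
  have lookF: "Poly_Mapping.lookup ?F u = (if u = exps n a then 1 else 0)" for u
    by (auto simp: prod_X_power lookup_single when_def)
  have lim: "(\<lambda>k. Poly_Mapping.lookup (G k) u) \<longlonglongrightarrow> Poly_Mapping.lookup ?F u" for u
  proof (cases "u \<in> Mon n ?d")
    case False
    then have "Poly_Mapping.lookup (G k) u = 0" for k by (simp add: G_def lookup_sum lookup_linear_form_power)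
    moreover have "u \<noteq> exps n a" using False exps_Mon by blast
    ultimately show ?thesis by (simp add: lookF)
  next
    case u: True
    have root_sum: "(\<Sum>z\<in>Z i. z ^ (Poly_Mapping.lookup u i + 1)) = (if (a i + 1) dvd (Poly_Mapping.lookup u i + 1) then of_nat (a i + 1) else 0)" for i
      unfolding Z_def by (rule sum_roots_unity_power) simp
    consider "u = exps n a" | "u \<noteq> exps n a" "R u = 0" | "u \<noteq> exps n a" "R u \<noteq> 0" by blast
    then show ?thesis
    proof cases
      case 1
      have "R u = of_nat P" unfolding R_def root_sum P_def of_nat_prod
        by (intro prod.cong) (auto simp: 1 lookup_exps)
      moreover have "T u = S" by (simp add: T_def S_def 1 lookup_exps)
      moreover have "(of_nat P :: complex) \<noteq> 0" unfolding of_nat_eq_0_iff by (simp add: P_def)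
      ultimately have "Poly_Mapping.lookup (G k) u = 1" for k
        unfolding G[OF u] C_def using s0[of k] fact_exps_nonzero[of n u] by (simp add: 1[symmetric])
      then show ?thesis by (simp add: lookF 1)
    next
      case 2
      then show ?thesis by (simp add: lookF G[OF u])
    next
      case 3
      \<comment> \<open>A nonzero \<open>R u\<close> makes \<open>a i + 1\<close> divide the
        positive number one above the exponent of \<open>u\<close> at \<open>i\<close>, so that
        exponent is at least \<open>a i\<close>.\<close>
      have ge: "a i \<le> Poly_Mapping.lookup u i" if "i < n" for i
      proof -
        have "(a i + 1) dvd (Poly_Mapping.lookup u i + 1)"
        proof (rule ccontr)
          assume "\<not> ?thesis"
          then have "R u = 0" unfolding R_def root_sum using that by (intro prod_zero) auto
          with 3 show False by simp
        qed
        from dvd_imp_le[OF this] show ?thesis by simp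
      qed
      \<comment> \<open>Equality would fix the exponents below \<open>n\<close>, and the degree then
        fixes the last one. Hence a positive power of \<open>s k\<close> remains.\<close>
      have "T u \<noteq> S"
      proof
        assume eq: "T u = S"
        have low: "Poly_Mapping.lookup u i = a i" if "i < n" for i
        proof (rule ccontr)
          assume "Poly_Mapping.lookup u i \<noteq> a i"
          then have "\<exists>i\<in>{..<n}. a i < Poly_Mapping.lookup u i" using ge that by (metis lessThan_iff le_neq_implies_less)
          then have "S < T u" unfolding S_def T_def
            by (intro sum_strict_mono_ex1[OF finite_lessThan]) (use ge in auto)
          with eq show False by simp
        qed
        have "T u + Poly_Mapping.lookup u n = S + a n"
          using u unfolding Mon_def T_def S_def lessThan_Suc_atMost[symmetric] by simp
        then have "Poly_Mapping.lookup u n = a n" using eq by simp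
        then have "Poly_Mapping.lookup u i = Poly_Mapping.lookup (exps n a) i" for i
          using low[of i] u by (cases "i = n") (auto simp: lookup_exps Mon_def in_keys_iff)
        then have "u = exps n a" by (rule poly_mapping_eqI)
        with 3 show False by simp
      qed
      moreover have "S \<le> T u" unfolding S_def T_def using ge by (intro sum_mono) auto
      ultimately have less: "S < T u" by simp
      have "s k ^ T u / s k ^ S = s k ^ (T u - S)" for k
        using less s0[of k] by (simp add: power_diff)
      moreover have "(\<lambda>k. s k ^ (T u - S)) \<longlonglongrightarrow> 0 ^ (T u - S)" by (intro tendsto_power s_lim)
      then have "(\<lambda>k. s k ^ (T u - S)) \<longlonglongrightarrow> 0" using less by (simp add: power_0_left)
      ultimately have "(\<lambda>k. s k ^ T u / s k ^ S) \<longlonglongrightarrow> 0" by simp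
      then have "(\<lambda>k. fact ?d / fact_exps n u * C * (s k ^ T u / s k ^ S) * R u) \<longlonglongrightarrow>
          fact ?d / fact_exps n u * C * 0 * R u"
        by (intro tendsto_mult tendsto_const)
      then show ?thesis using 3 by (simp add: G[OF u] lookF)
    qed
  qed
  have "\<exists>v. (\<forall>j<P. v j \<in> veronese_cone n ?d) \<and> G k = (\<Sum>j<P. v j)" for k
    by (intro exI[of _ "\<lambda>j. (\<Sum>i\<le>n. Const (c k (h j) i) * X i) ^ ?d"])
      (auto simp: veronese_cone_def linear_forms_def G_def)
  then show ?thesis using lim monomial_in_forms unfolding secant_cone_def P_def by blast
qed

theorem theorem8p21:
  fixes n :: nat and a :: "nat \<Rightarrow> nat"
  assumes "n \<ge> 1"
    and "0 < a 0"
    and "\<And>i. i < n \<Longrightarrow> a i \<le> a (Suc i)"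
    and "int (a n) \<ge> (\<Sum>i<n. int (a i)) - 2"
  shows "border_rank n (\<Sum>i\<le>n. a i) (\<Prod>i\<le>n. X i ^ a i) = (\<Prod>i<n. (a i + 1))"
proof -
  have sorted: "a i \<le> a j" if "i \<le> j" "j \<le> n" for i j
    using that by (induction j rule: dec_induct) (use assms(3) in \<open>auto intro: order_trans\<close>)
  have pos: "1 \<le> a i" if "i \<le> n" for i
    using sorted[of 0 i] that assms(2) by simp
  have "int (\<Sum>i<n. a i) \<le> int (a n + 2)" using assms(4) by simp
  then have last_ge: "(\<Sum>i<n. a i) \<le> a n + 2" by (simp only: of_nat_le_iff)
  have "1 \<le> a n" using pos by simp
  also have "a n \<le> (\<Sum>i\<le>n. a i)" by (rule member_le_sum) auto
  finally have d: "1 \<le> (\<Sum>i\<le>n. a i)" .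
  show ?thesis
    unfolding border_rank_def
  proof (rule Least_equality)
    have "0 < (\<Prod>i<n. a i + 1)" by (rule prod_pos) simp
    then show "1 \<le> (\<Prod>i<n. a i + 1) \<and>
        (\<Prod>i\<le>n. X i ^ a i) \<in> secant_cone n (\<Sum>i\<le>n. a i) (\<Prod>i<n. a i + 1)"
      using monomial_in_secant_cone[OF d] by (intro conjI) linarith
  qed (use border_rank_monomial_ge[OF assms(1) pos _ last_ge] sorted in blast)
qed

end
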